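(* Let $G$ be a $\{3K_1,\text{paraglider}\}$-free graph. Then $\chi(G)\le\max\{\omega(G)+3,\,2\omega(G)-2\}$. More precisely, if $G$ is imperfect and $H$ is the imperfect component of $\overline{G}$ (with a fixed induced 5-cycle chosen in $H$ as in the context), then $\chi(G)\le 2\omega(G)-2$ if $H\in\mathcal B_1$; $\chi(G)\le 3\omega(G)/2-1$ if $H\in\mathcal B_2$; and $\chi(G)\le\omega(G)+3$ otherwise. Moreover, each of the bounds $2\omega(G)-2$, $3\omega(G)/2-1$ and $\omega(G)+3$ is tight in its respective case (attained with equality by some imperfect $\{3K_1,\text{paraglider}\}$-free graph $G$ falling into that case).
   Context: $3K_1$ is the edgeless graph on 3 vertices; a paraglider is a 4-cycle plus a vertex adjacent to exactly three of its vertices; $\mathcal F$-free means no induced subgraph isomorphic to a member of $\mathcal F$. A graph is perfect if $\chi(F)=\omega(F)$ for every induced subgraph $F$; otherwise imperfect. For imperfect such $G$, $\overline{G}$ has exactly one imperfect component $H$, and $H$ is connected, imperfect, and has no induced triangle $K_3$ and no induced $P_2\cup P_3$ (disjoint union of an edge and a path on 3 vertices); such $H$ contains an induced 5-cycle. Setup: fix an induced 5-cycle in $H$ with vertices $v_1,\dots,v_5$ in cyclic order, indices modulo 5, $S_0=\{v_1,\dots,v_5\}$. For $x\notin S_0$ let $d(x,S_0)$ be the distance from $x$ to $S_0$, and $S_k=\{x\in V(H)\setminus S_0: d(x,S_0)=k\}$. Let $A_i=\{x\in S_1: N(x)\cap S_0=\{v_i\}\}$ and $B_i=\{x\in S_1: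 N(x)\cap S_0=\{v_{i-1},v_{i+1}\}\}$. Let $h_A$, $h_B$ be the number of nonempty sets among $A_1,\dots,A_5$ and among $B_1,\dots,B_5$, respectively. For sets $S,T$, $[S,T]$ is the set of edges with one end in $S$ and the other in $T$; $N(S)$ is the set of vertices outside $S$ with a neighbor in $S$. $H\in\mathcal B_1$ means: $h_B=2$ and $S_2\ne\emptyset$; for some $i$, $B_i,B_{i+1}\ne\emptyset$, $[B_i,B_{i+1}]\ne\emptyset$ and $A_{i-2}=\emptyset$; and $\big||B_i\setminus N(S_2)|-|B_{i+1}\setminus N(S_2)|\big|<|M|$, where $M\neq\emptyset$ is the set of nonadjacent pairs $\{x,y\}$ with $x\in N(S_2)\cap B_i$, $y\in N(S_2)\cap B_{i+1}$. $H\in\mathcal B_2$ means: $S_2=\emptyset$, $h_A=0$, $h_B=5$, and $[B_j,B_{j+1}]\ne\emptyset$ for every $j$. *)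

theory Defs
  imports
    Complex_Main
    "HOL-Library.Extended_Nat"
    "HOL-Library.Numeral_Type"
begin

record 'a graph =
  verts :: "'a set"
  edges :: "'a set set"

definition simple_graph :: "'a graph \<Rightarrow> bool" where
  "simple_graph G \<longleftrightarrow>
     finite (verts G) \<and> (\<forall>e\<in>edges G. e \<subseteq> verts G \<and> card e = 2)"

definition adj :: "'a graph \<Rightarrow> 'a \<Rightarrow> 'a \<Rightarrow> bool" where
  "adj G x y \<longleftrightarrow> {x, y} \<in> edges G"

definition induced :: "'a graph \<Rightarrow> 'a set \<Rightarrow> 'a graph" where
  "induced G W = \<lparr>verts = W, edges = {e \<in> edges G. e \<subseteq> W}\<rparr>"

definition complement :: "'a graph \<Rightarrow> 'a graph" where
  "complement G =
     \<lparr>verts = verts G,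
      edges = {{x, y} | x y. x \<in> verts G \<and> y \<in> verts G \<and> x \<noteq> y \<and> {x, y} \<notin> edges G}\<rparr>"

definition isomorphic :: "'a graph \<Rightarrow> 'b graph \<Rightarrow> bool" where
  "isomorphic F G \<longleftrightarrow>
     (\<exists>f. bij_betw f (verts F) (verts G) \<and>
          (\<forall>x\<in>verts F. \<forall>y\<in>verts F. adj F x y \<longleftrightarrow> adj G (f x) (f y)))"

definition free_of :: "'b graph set \<Rightarrow> 'a graph \<Rightarrow> bool" where
  "free_of \<F> G \<longleftrightarrow> (\<forall>F\<in>\<F>. \<not> (\<exists>W\<subseteq>verts G. isomorphic (induced G W) F))"

definition three_K1 :: "nat graph" where
  "three_K1 = \<lparr>verts = {0, 1, 2}, edges = {}\<rparr>"

definition paraglider :: "nat graph" where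
  "paraglider =
     \<lparr>verts = {0, 1, 2, 3, 4},
      edges = {{0, 1}, {1, 2}, {2, 3}, {3, 0}} \<union> {{4, 0}, {4, 1}, {4, 2}}\<rparr>"

definition colorable :: "'a graph \<Rightarrow> nat \<Rightarrow> bool" where
  "colorable G k \<longleftrightarrow>
     (\<exists>c :: 'a \<Rightarrow> nat. (\<forall>x\<in>verts G. c x < k) \<and>
        (\<forall>x\<in>verts G. \<forall>y\<in>verts G. adj G x y \<longrightarrow> c x \<noteq> c y))"

definition chromatic_number :: "'a graph \<Rightarrow> nat" ("\<chi>") where
  "\<chi> G = (LEAST k. colorable G k)"

definition is_clique :: "'a graph \<Rightarrow> 'a set \<Rightarrow> bool" where
  "is_clique G K \<longleftrightarrow> K \<subseteq> verts G \<and> (\<forall>x\<in>K. \<forall>y\<in>K. x \<noteq> y \<longrightarrow> adj G x y)"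

definition clique_number :: "'a graph \<Rightarrow> nat" ("\<omega>") where
  "\<omega> G = Max {card K | K. is_clique G K}"

definition perfect :: "'a graph \<Rightarrow> bool" where
  "perfect G \<longleftrightarrow> (\<forall>W\<subseteq>verts G. \<chi> (induced G W) = \<omega> (induced G W))"

definition is_component :: "'a graph \<Rightarrow> 'a graph \<Rightarrow> bool" where
  "is_component H G \<longleftrightarrow>
     (\<exists>x\<in>verts G. H = induced G {y. (adj G)\<^sup>*\<^sup>* x y})"

text \<open>The value is \<open>\<infinity>\<close> if no walk joins \<open>x\<close> to \<open>S\<close>.\<close>

definition dist_to :: "'a graph \<Rightarrow> 'a \<Rightarrow> 'a set \<Rightarrow> enat" where
  "dist_to G x S = (INF n\<in>{n. \<exists>s\<in>S. (adj G ^^ n) x s}. enat n)"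

definition nbrs :: "'a graph \<Rightarrow> 'a \<Rightarrow> 'a set" where
  "nbrs G x = {y \<in> verts G. adj G x y}"

definition nbrs_of_set :: "'a graph \<Rightarrow> 'a set \<Rightarrow> 'a set" where
  "nbrs_of_set G S = {y \<in> verts G - S. \<exists>x\<in>S. adj G x y}"

definition edges_between :: "'a graph \<Rightarrow> 'a set \<Rightarrow> 'a set \<Rightarrow> 'a set set" where
  "edges_between G S T = {e \<in> edges G. \<exists>x\<in>S. \<exists>y\<in>T. e = {x, y}}"

text \<open>The vertices of the 5-cycle are indexed by the five-element type \<open>5\<close>, whose arithmetic
  is arithmetic modulo 5; the index 5 is the element \<open>0\<close>.\<close>

definition induced_5_cycle :: "'a graph \<Rightarrow> (5 \<Rightarrow> 'a) \<Rightarrow> bool" where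
  "induced_5_cycle H v \<longleftrightarrow>
     inj v \<and> range v \<subseteq> verts H \<and>
     (\<forall>i j. adj H (v i) (v j) \<longleftrightarrow> j = i + 1 \<or> i = j + 1)"

definition layer :: "'a graph \<Rightarrow> (5 \<Rightarrow> 'a) \<Rightarrow> nat \<Rightarrow> 'a set" where
  "layer H v k = {x \<in> verts H - range v. dist_to H x (range v) = enat k}"

definition A_set :: "'a graph \<Rightarrow> (5 \<Rightarrow> 'a) \<Rightarrow> 5 \<Rightarrow> 'a set" where
  "A_set H v i = {x \<in> layer H v 1. nbrs H x \<inter> range v = {v i}}"

definition B_set :: "'a graph \<Rightarrow> (5 \<Rightarrow> 'a) \<Rightarrow> 5 \<Rightarrow> 'a set" where
  "B_set H v i = {x \<in> layer H v 1. nbrs H x \<inter> range v = {v (i - 1), v (i + 1)}}"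

definition h_A :: "'a graph \<Rightarrow> (5 \<Rightarrow> 'a) \<Rightarrow> nat" where
  "h_A H v = card {i. A_set H v i \<noteq> {}}"

definition h_B :: "'a graph \<Rightarrow> (5 \<Rightarrow> 'a) \<Rightarrow> nat" where
  "h_B H v = card {i. B_set H v i \<noteq> {}}"

definition M_set :: "'a graph \<Rightarrow> (5 \<Rightarrow> 'a) \<Rightarrow> 5 \<Rightarrow> 'a set set" where
  "M_set H v i =
     {{x, y} | x y. x \<in> nbrs_of_set H (layer H v 2) \<inter> B_set H v i \<and>
                    y \<in> nbrs_of_set H (layer H v 2) \<inter> B_set H v (i + 1) \<and> \<not> adj H x y}"

definition class_B1 :: "'a graph \<Rightarrow> (5 \<Rightarrow> 'a) \<Rightarrow> bool" where
  "class_B1 H v \<longleftrightarrow>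
     h_B H v = 2 \<and> layer H v 2 \<noteq> {} \<and>
     (\<exists>i. B_set H v i \<noteq> {} \<and> B_set H v (i + 1) \<noteq> {} \<and>
          edges_between H (B_set H v i) (B_set H v (i + 1)) \<noteq> {} \<and>
          A_set H v (i - 2) = {} \<and>
          M_set H v i \<noteq> {} \<and>
          \<bar>int (card (B_set H v i - nbrs_of_set H (layer H v 2))) -
           int (card (B_set H v (i + 1) - nbrs_of_set H (layer H v 2)))\<bar>
            < int (card (M_set H v i)))"

definition class_B2 :: "'a graph \<Rightarrow> (5 \<Rightarrow> 'a) \<Rightarrow> bool" where
  "class_B2 H v \<longleftrightarrow>
     layer H v 2 = {} \<and> h_A H v = 0 \<and> h_B H v = 5 \<and>
     (\<forall>j. edges_between H (B_set H v j) (B_set H v (j + 1)) \<noteq> {})"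

text \<open>\<open>G\<close> is an imperfect \<open>{3K\<^sub>1, paraglider}\<close>-free graph, \<open>H\<close> is the imperfect component of
  its complement, and \<open>v\<close> is the chosen induced 5-cycle of \<open>H\<close>.\<close>

definition admissible :: "'a graph \<Rightarrow> 'a graph \<Rightarrow> (5 \<Rightarrow> 'a) \<Rightarrow> bool" where
  "admissible G H v \<longleftrightarrow>
     simple_graph G \<and> free_of {three_K1, paraglider} G \<and> \<not> perfect G \<and>
     is_component H (complement G) \<and> \<not> perfect H \<and> induced_5_cycle H v"

end

(* Colour classes of G are cliques of the complement, which has no triangle; so chi(G) is the least
   number of vertices and edges covering the complement, and omega(G) is its stability number.
   A triangle-free graph with no induced P_2 + P_3 is either bipartite, and Koenig's theorem gives
   chi(G) = omega(G), or it contains an induced 5-cycle around which its structure is rigid: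
   |A_i| <= 1, [B_i, B_(i+1)] is complete up to a matching, and each vertex of B_i has at most one
   neighbour in S_2.  Deleting at most three cliques then leaves a bipartite graph, which yields
   omega(G) + 3, with two exceptions.  If only two consecutive sets B_i survive, the bipartition must
   break up the triples formed by a nonadjacent pair and its common neighbour in S_2, and the loss is
   controlled by the balance condition of B_1.  In B_2 the complement is a blow-up of the 5-cycle
   (or very small); five edges meeting every part lower the stability number by 4, and deleting one
   more small part leaves a bipartite graph.
   For the lower bounds, chi(G) is at least |V(G)|/2. *)
theory Submission
  imports Defs
begin

text \<open>The bounds are proved in the whole complement; the component H enters only when
  \<open>class_B1\<close> and \<open>class_B2\<close> are translated into \<open>type1\<close> and
  \<open>type2\<close>. This is harmless because an edge away from the 5-cycle and unattached to it
  would give an induced P_2 + P_3. The constant 3 is cheap because A_i together with A_(i+2) is a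
  clique: two cliques absorb four of the sets A_i, and one clique is left for an edge or vertex of
  the cycle or for an exceptional vertex of S_2. The obstacle of B_1 is a vertex z of S_2 seeing
  both x in B_0 and y in B_1: then x z y v_0 v_1 is a 5-cycle, and each such z makes its own.
  Koenig's theorem is therefore applied after deleting edges inside the two sides. A cover found
  there is still a cover, but the stability number may grow. The growth is bounded by counting,
  against lower bounds for the stability number that come from explicit stable sets.\<close>

lemma UNIV_5: "(UNIV :: 5 set) = {0, 1, 2, 3, 4}"
  by (rule sym, rule card_subset_eq) simp_all

lemma cases_5: "j = 0 \<or> j = 1 \<or> j = 2 \<or> j = 3 \<or> j = 4" for j :: 5
  using UNIV_5 by blast

lemma five_eq_0 [simp]: "(5 :: 5) = 0"
  using cases_5[of 5] by (elim disjE) simp_all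

lemma mod_5 [simp]: "(6 :: 5) = 1" "(7 :: 5) = 2" "(8 :: 5) = 3" "(9 :: 5) = 4"
  by simp_all

lemma neg_5: "(- 1 :: 5) = 4" "(- 2 :: 5) = 3" "(- 3 :: 5) = 2" "(- 4 :: 5) = 1"
  by simp_all

lemma all_5: "(\<forall>j :: 5. Q j) \<longleftrightarrow> Q 0 \<and> Q 1 \<and> Q 2 \<and> Q 3 \<and> Q 4"
  using UNIV_5 by (metis UNIV_I insert_iff empty_iff)

lemma ex_5: "(\<exists>j :: 5. Q j) \<longleftrightarrow> Q 0 \<or> Q 1 \<or> Q 2 \<or> Q 3 \<or> Q 4"
  using all_5[of "\<lambda>j. \<not> Q j"] by blast

section \<open>Clique covers and stability number\<close>

text \<open>Encoded as a map into the numbers below \<open>k\<close>, so that it is literally a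
  colouring of the complementary graph; empty classes are allowed, which gives monotonicity in
  \<open>k\<close>.\<close>

definition clique_cover :: "('a \<Rightarrow> 'a \<Rightarrow> bool) \<Rightarrow> 'a set \<Rightarrow> nat \<Rightarrow> bool" where
  "clique_cover E V k \<longleftrightarrow>
     (\<exists>c :: 'a \<Rightarrow> nat. (\<forall>x\<in>V. c x < k) \<and> (\<forall>x\<in>V. \<forall>y\<in>V. c x = c y \<longrightarrow> x = y \<or> E x y))"

definition stable :: "('a \<Rightarrow> 'a \<Rightarrow> bool) \<Rightarrow> 'a set \<Rightarrow> bool" where
  "stable E S \<longleftrightarrow> (\<forall>x\<in>S. \<forall>y\<in>S. \<not> E x y)"

text \<open>A bound instead of the maximum is inherited by subsets and can be transferred to an
  auxiliary relation with fewer edges.\<close>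

definition stability_le :: "('a \<Rightarrow> 'a \<Rightarrow> bool) \<Rightarrow> 'a set \<Rightarrow> nat \<Rightarrow> bool" where
  "stability_le E V a \<longleftrightarrow> (\<forall>S\<subseteq>V. stable E S \<longrightarrow> card S \<le> a)"

lemma clique_cover_mono:
  assumes "clique_cover E V k" "W \<subseteq> V" "k \<le> m"
  shows "clique_cover E W m"
proof -
  from assms(1) obtain c where
    "\<forall>x\<in>V. c x < k" "\<forall>x\<in>V. \<forall>y\<in>V. c x = c y \<longrightarrow> x = y \<or> E x y"
    unfolding clique_cover_def by blast
  with assms(2,3) have "(\<forall>x\<in>W. c x < m) \<and> (\<forall>x\<in>W. \<forall>y\<in>W. c x = c y \<longrightarrow> x = y \<or> E x y)"
    by (meson less_le_trans subsetD)
  then show ?thesis unfolding clique_cover_def by (intro exI[of _ c])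
qed

lemma clique_cover_edge_mono:
  "clique_cover E V k \<Longrightarrow> (\<And>x y. E x y \<Longrightarrow> F x y) \<Longrightarrow> clique_cover F V k"
  unfolding clique_cover_def by blast

lemma clique_cover_union:
  assumes "clique_cover E U k" "clique_cover E W m"
  shows "clique_cover E (U \<union> W) (k + m)"
proof -
  from assms obtain c d where c: "\<forall>x\<in>U. c x < k" "\<forall>x\<in>U. \<forall>y\<in>U. c x = c y \<longrightarrow> x = y \<or> E x y"
    and d: "\<forall>x\<in>W. d x < m" "\<forall>x\<in>W. \<forall>y\<in>W. d x = d y \<longrightarrow> x = y \<or> E x y"
    unfolding clique_cover_def by blast
  let ?f = "\<lambda>x. if x \<in> U then c x else k + d x"
  have "\<forall>x\<in>U \<union> W. ?f x < k + m" using c d by auto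
  moreover have "\<forall>x\<in>U \<union> W. \<forall>y\<in>U \<union> W. ?f x = ?f y \<longrightarrow> x = y \<or> E x y"
    using c d by (auto split: if_splits)
  ultimately show ?thesis unfolding clique_cover_def by (intro exI[of _ ?f]) auto
qed

lemma clique_cover_one: "(\<And>x y. x \<in> K \<Longrightarrow> y \<in> K \<Longrightarrow> x \<noteq> y \<Longrightarrow> E x y) \<Longrightarrow> clique_cover E K 1"
  unfolding clique_cover_def by (rule exI[of _ "\<lambda>_. 0"]) auto

lemma clique_cover_empty: "clique_cover E {} k"
  unfolding clique_cover_def by auto

lemma clique_cover_card: "finite V \<Longrightarrow> clique_cover E V (card V)"
proof (induction V rule: finite_induct)
  case (insert x V)
  have "clique_cover E ({x} \<union> V) (1 + card V)"
    by (intro clique_cover_union clique_cover_one insert.IH) auto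
  then show ?case using insert by simp
qed (rule clique_cover_empty)

lemma stable_subset: "stable E S \<Longrightarrow> T \<subseteq> S \<Longrightarrow> stable E T"
  unfolding stable_def by blast

lemma stability_le_mono: "stability_le E V a \<Longrightarrow> W \<subseteq> V \<Longrightarrow> a \<le> b \<Longrightarrow> stability_le E W b"
  unfolding stability_le_def by (meson le_trans subset_trans)

text \<open>If deleting both ends of an edge keeps the stability number, a maximum
  stable set avoiding that edge splits the graph into two smaller bipartite graphs whose stability
  numbers add up to the original one.\<close>

theorem koenig:
  assumes "finite L" "finite R" "L \<inter> R = {}" "stable E L" "stable E R"
    and sym: "\<And>x y. E x y \<Longrightarrow> E y x" and "stability_le E (L \<union> R) a"
  shows "clique_cover E (L \<union> R) a"
  using assms(1-5,7)
proof (induction "card (L \<union> R)" arbitrary: L R a rule: less_induct)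
  case less
  show ?case
  proof (cases "\<exists>x\<in>L. \<exists>y\<in>R. E x y")
    case False
    then have "stable E (L \<union> R)" using less.prems sym unfolding stable_def by blast
    then have "card (L \<union> R) \<le> a" using less.prems unfolding stability_le_def by blast
    then show ?thesis using clique_cover_card[of "L \<union> R" E] less.prems(1,2)
      by (meson clique_cover_mono finite_UnI subset_refl)
  next
    case True
    then obtain x y where xy: "x \<in> L" "y \<in> R" "E x y" by blast
    have ne: "x \<noteq> y" using xy less.prems(3) by blast
    let ?W = "(L - {x}) \<union> (R - {y})"
    have W: "?W \<subset> L \<union> R" using xy less.prems(3) by blast
    have fin: "finite (L \<union> R)" using less.prems by simp
    show ?thesis
    proof (cases "stability_le E ?W (a - 1)")
      case True
      have IH: "clique_cover E ?W (a - 1)"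
        by (rule less.hyps[OF psubset_card_mono[OF fin W]])
          (use less.prems True in \<open>auto intro: stable_subset\<close>)
      \<comment> \<open>This leads to \<open>a \<ge> 1\<close>, required for
        \<open>1 + (a - 1) = a\<close> since subtraction is truncated.\<close>
      have "stable E {x} \<or> E x x" unfolding stable_def by blast
      then have "stable E {x}" using less.prems(4) xy unfolding stable_def by blast
      then have "card {x} \<le> a" using less.prems(6) xy unfolding stability_le_def
        by (meson UnI1 empty_subsetI insert_subset)
      then have "a \<ge> 1" by simp
      have "clique_cover E ({x, y} \<union> ?W) (1 + (a - 1))"
        by (intro clique_cover_union clique_cover_one IH) (use xy sym in auto)
      moreover have "{x, y} \<union> ?W = L \<union> R" using xy by blast
      ultimately show ?thesis using \<open>a \<ge> 1\<close> by simp
    next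
      case False
      then obtain S where S: "S \<subseteq> ?W" "stable E S" "\<not> card S \<le> a - 1"
        unfolding stability_le_def by blast
      have "card S \<le> a" using S(1,2) W less.prems(6) unfolding stability_le_def by blast
      with S(3) have cS: "card S = a" by simp
      have finS: "finite S" using S W fin by (meson finite_subset psubset_imp_subset)
      let ?SL = "S \<inter> L" and ?SR = "S \<inter> R"
      have split: "card ?SL + card ?SR = a"
        using cS S(1) less.prems(3) finS
        by (subst card_Un_disjoint[symmetric]) (auto intro!: arg_cong[of _ _ card])
      \<comment> \<open>\<open>A\<close> is the side on which the piece keeps \<open>S\<close>,
        \<open>B\<close> the side on which it takes what \<open>S\<close> misses; both orders of the
        sides are used.\<close>
      have key: "clique_cover E ((S \<inter> A) \<union> (B - S)) (card (S \<inter> A))"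
        if AB: "A = L \<and> B = R \<or> A = R \<and> B = L" for A B
      proof (rule less.hyps)
        show "card ((S \<inter> A) \<union> (B - S)) < card (L \<union> R)"
          by (rule psubset_card_mono[OF fin]) (use that xy S ne less.prems(3) in auto)
        show "finite (S \<inter> A)" "finite (B - S)" "S \<inter> A \<inter> (B - S) = {}"
          using that less.prems by auto
        show "stable E (S \<inter> A)" "stable E (B - S)"
          using that less.prems by (auto intro: stable_subset)
        show "stability_le E ((S \<inter> A) \<union> (B - S)) (card (S \<inter> A))"
          unfolding stability_le_def
        proof (intro allI impI)
          fix J assume J: "J \<subseteq> (S \<inter> A) \<union> (B - S)" "stable E J"
          have "stable E B" using that less.prems by auto
          \<comment> \<open>In \<open>A\<close> the set \<open>J\<close> stays inside
            \<open>S\<close>, so nothing there is joined to \<open>S \<inter> B\<close>; the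
            vertices of \<open>J\<close> in \<open>B\<close> are covered by the stability of
            \<open>B\<close>.\<close>
          then have "stable E (J \<union> (S \<inter> B))"
            using J S(2) sym unfolding stable_def by blast
          moreover have "J \<union> (S \<inter> B) \<subseteq> L \<union> R" using J that by auto
          ultimately have "card (J \<union> (S \<inter> B)) \<le> a"
            using less.prems(6) unfolding stability_le_def by blast
          moreover have "finite J" using J(1) that fin finS less.prems(1,2)
            by (meson finite_Diff finite_Int finite_UnI finite_subset)
          moreover have "J \<inter> (S \<inter> B) = {}" using J(1) that less.prems(3) by auto
          ultimately have "card J + card (S \<inter> B) \<le> a"
            using finS by (simp add: card_Un_disjoint)
          moreover have "card (S \<inter> A) + card (S \<inter> B) = a" using split AB by auto
          ultimately show "card J \<le> card (S \<inter> A)" by linarith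
        qed
      qed
      have "clique_cover E (((S \<inter> L) \<union> (R - S)) \<union> ((S \<inter> R) \<union> (L - S))) (card ?SL + card ?SR)"
        by (rule clique_cover_union[OF key key]) auto
      moreover have "((S \<inter> L) \<union> (R - S)) \<union> ((S \<inter> R) \<union> (L - S)) = L \<union> R" by blast
      ultimately show ?thesis using split by simp
    qed
  qed
qed

section \<open>Triangle-free graphs without an induced edge plus path, around a 5-cycle\<close>

text \<open>The axiom \<open>p2p3\<close> expresses inducedness without disjointness conditions: an
  edge that meets the path satisfies the conclusion through the path itself, and the ends
  \<open>p\<close>, \<open>r\<close> are nonadjacent by \<open>tri\<close>.\<close>

locale p2p3_graph =
  fixes V :: "'a set" and E :: "'a \<Rightarrow> 'a \<Rightarrow> bool"
  assumes fin: "finite V"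
    and adj_in: "E x y \<Longrightarrow> x \<in> V"
    and adj_sym: "E x y \<Longrightarrow> E y x"
    and tri: "E x y \<Longrightarrow> E y z \<Longrightarrow> \<not> E x z"
    and p2p3: "E a b \<Longrightarrow> E p q \<Longrightarrow> E q r \<Longrightarrow> p \<noteq> r \<Longrightarrow>
      E a p \<or> E a q \<or> E a r \<or> E b p \<or> E b q \<or> E b r"
begin

lemma irr: "\<not> E x x"
  using tri by blast

lemma common_nbr: "E x z \<Longrightarrow> E y z \<Longrightarrow> \<not> E x y"
  using tri adj_sym by blast

lemma koenig_parts:
  assumes "L \<subseteq> V" "R \<subseteq> V" "L \<inter> R = {}" "stable E L" "stable E R" "stability_le E (L \<union> R) a"
  shows "clique_cover E (L \<union> R) a"
  using koenig[of L R E a] assms fin adj_sym by (meson finite_subset)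

end

lemma rel_5: "j = i \<or> j = i + 1 \<or> j = i + 2 \<or> j = i + 3 \<or> j = i + 4" for i j :: 5
  using cases_5[of "j - i"] by (auto simp: algebra_simps)

locale cycle_graph = p2p3_graph +
  fixes v :: "5 \<Rightarrow> 'a"
  assumes inj_v: "inj v"
    and cyc: "E (v i) (v j) \<longleftrightarrow> j = i + 1 \<or> i = j + 1"
begin

text \<open>The whole graph \<open>V\<close> is the complement of \<open>G\<close>, so \<open>Z\<close> consists of \<open>S\<^sub>2\<close> and of isolated vertices
  outside the component \<open>H\<close>.  A cycle vertex behaves like a vertex of its own set \<open>B i\<close>;
  \<open>P i\<close> is \<open>B i\<close> together with it.\<close>

definition P :: "5 \<Rightarrow> 'a set" where
  "P i = {x \<in> V. \<forall>j. E x (v j) \<longleftrightarrow> j = i + 1 \<or> j = i + 4}"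

definition A :: "5 \<Rightarrow> 'a set" where
  "A i = {x \<in> V. \<forall>j. E x (v j) \<longleftrightarrow> j = i}"

definition Z :: "'a set" where
  "Z = {x \<in> V. \<forall>j. \<not> E x (v j)}"

definition B :: "5 \<Rightarrow> 'a set" where
  "B i = P i - {v i}"

text \<open>Offsets point in one direction only, so that index comparisons reduce to
  \<open>rel_5\<close>.\<close>

lemma vv: "E (v i) (v j) \<longleftrightarrow> j = i + 1 \<or> j = i + 4"
  unfolding cyc using rel_5[of j i] by auto

lemma adj_comm: "E x y \<longleftrightarrow> E y x"
  using adj_sym by blast

lemma v_in: "v i \<in> V"
  using adj_in[of "v i" "v (i + 1)"] by (simp add: vv)

lemma v_P: "v i \<in> P i"
  unfolding P_def using v_in vv by auto

lemma P_v: "x \<in> P i \<Longrightarrow> E x (v j) \<longleftrightarrow> j = i + 1 \<or> j = i + 4"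
  and P_v': "x \<in> P i \<Longrightarrow> E (v j) x \<longleftrightarrow> j = i + 1 \<or> j = i + 4"
  unfolding P_def using adj_comm by auto

lemma A_v: "x \<in> A i \<Longrightarrow> E x (v j) \<longleftrightarrow> j = i"
  and A_v': "x \<in> A i \<Longrightarrow> E (v j) x \<longleftrightarrow> j = i"
  unfolding A_def using adj_comm by auto

lemma Z_v: "x \<in> Z \<Longrightarrow> \<not> E x (v j)"
  and Z_v': "x \<in> Z \<Longrightarrow> \<not> E (v j) x"
  unfolding Z_def using adj_comm by auto

lemmas to_v = vv P_v P_v' A_v A_v' Z_v Z_v'

lemma sub_V: "P i \<subseteq> V" "A i \<subseteq> V" "Z \<subseteq> V" "B i \<subseteq> V"
  unfolding P_def A_def Z_def B_def by auto

lemma fin_parts [simp]: "finite (P i)" "finite (A i)" "finite Z" "finite (B i)"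
  using sub_V fin finite_subset by metis+

lemma B_P: "x \<in> B i \<Longrightarrow> x \<in> P i"
  unfolding B_def by simp

lemma P_eq: "P i = insert (v i) (B i)"
  unfolding B_def using v_P by auto

lemma v_notin_B: "v j \<notin> B i"
proof
  assume "v j \<in> B i"
  then have P: "v j \<in> P i" and ne: "j \<noteq> i" unfolding B_def by auto
  show False using P_v[OF P, of "i + 1"] P_v[OF P, of "i + 4"] ne rel_5[of j i] by (auto simp: vv)
qed

lemma B_D: "x \<in> B i \<Longrightarrow> x \<in> P i \<and> x \<noteq> v j \<and> v j \<noteq> x"
  using v_notin_B B_P by blast

lemma v_notin_A: "v j \<notin> A i"
proof
  assume P: "v j \<in> A i"
  show False using A_v[OF P, of "j + 1"] A_v[OF P, of "j + 4"] by (auto simp: vv)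
qed

lemma v_notin_Z: "v j \<notin> Z"
  using Z_v[of "v j" "j + 1"] by (auto simp: vv)

text \<open>No triangle means no two consecutive neighbours on the cycle, and the stable sets of a
  5-cycle are empty, single vertices, or pairs at distance two.\<close>

lemma V_cases: "x \<in> V \<Longrightarrow> x \<in> Z \<or> (\<exists>i. x \<in> A i) \<or> (\<exists>i. x \<in> P i)"
proof -
  assume x: "x \<in> V"
  have no: "\<not> (E x (v j) \<and> E x (v (j + 1)))" for j
    using tri[of x "v j" "v (j + 1)"] by (auto simp: vv)
  have "\<not> (E x (v 0) \<and> E x (v 1))" "\<not> (E x (v 1) \<and> E x (v 2))" "\<not> (E x (v 2) \<and> E x (v 3))"
    "\<not> (E x (v 3) \<and> E x (v 4))" "\<not> (E x (v 4) \<and> E x (v 0))"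
    using no[of 0] no[of 1] no[of 2] no[of 3] no[of 4] by simp_all
  then show ?thesis
    using x unfolding Z_def A_def P_def
    by (cases "E x (v 0)"; cases "E x (v 1)"; cases "E x (v 2)"; cases "E x (v 3)"; cases "E x (v 4)")
      (simp_all add: all_5 ex_5)
qed

lemma V_eq: "V = Z \<union> (A 0 \<union> A 1 \<union> A 2 \<union> A 3 \<union> A 4) \<union> (P 0 \<union> P 1 \<union> P 2 \<union> P 3 \<union> P 4)"
  using V_cases sub_V unfolding ex_5 by blast

lemma disj_PP: "x \<in> P i \<Longrightarrow> x \<in> P j \<Longrightarrow> i = j"
  using P_v[of x i "i + 1"] P_v[of x i "i + 4"] P_v[of x j "i + 1"] P_v[of x j "i + 4"] rel_5[of j i]
  by auto

lemma disj_AA: "x \<in> A i \<Longrightarrow> x \<in> A j \<Longrightarrow> i = j"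
  using A_v by blast

lemma disj_other: "x \<in> A i \<Longrightarrow> x \<notin> P j" "x \<in> A i \<Longrightarrow> x \<notin> Z" "x \<in> P i \<Longrightarrow> x \<notin> Z"
proof -
  show "x \<in> A i \<Longrightarrow> x \<notin> P j"
    using A_v[of x i "j + 1"] A_v[of x i "j + 4"] P_v[of x j "j + 1"] P_v[of x j "j + 4"] by auto
  show "x \<in> A i \<Longrightarrow> x \<notin> Z" using A_v Z_v by blast
  show "x \<in> P i \<Longrightarrow> x \<notin> Z" using P_v Z_v by blast
qed

section \<open>Adjacency between the parts\<close>

lemma PP: "x \<in> P i \<Longrightarrow> y \<in> P j \<Longrightarrow> E x y \<Longrightarrow> j = i + 1 \<or> j = i + 4"
  using common_nbr[of x "v (i + 1)" y] common_nbr[of x "v (i + 4)" y] rel_5[of j i]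
  by (auto simp: to_v)

lemma AP: "x \<in> A i \<Longrightarrow> y \<in> P j \<Longrightarrow> E x y \<Longrightarrow> j = i \<or> j = i + 2 \<or> j = i + 3"
  using common_nbr[of x "v i" y] rel_5[of j i] by (auto simp: to_v)

lemma PA: "y \<in> P j \<Longrightarrow> x \<in> A i \<Longrightarrow> E y x \<Longrightarrow> j = i \<or> j = i + 2 \<or> j = i + 3"
  using AP adj_sym by blast

text \<open>The model for the facts that follow: \<open>p2p3\<close> is applied to an edge and a
  path with most vertices on the cycle, so that \<open>to_v\<close> decides every cross pair except
  the one in question.\<close>

lemma AA_adjacent: "x \<in> A i \<Longrightarrow> y \<in> A (i + 1) \<Longrightarrow> \<not> E x y"
  using p2p3[of x y "v (i + 2)" "v (i + 3)" "v (i + 4)"] inj_v by (auto simp: to_v inj_eq)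

lemma AA: "x \<in> A i \<Longrightarrow> y \<in> A j \<Longrightarrow> E x y \<Longrightarrow> j = i + 2 \<or> j = i + 3"
  using common_nbr[of x "v i" y] AA_adjacent[of x i y] AA_adjacent[of y j x] rel_5[of j i]
  by (auto simp: to_v adj_comm[of y x])

lemma A_unique: "x \<in> A i \<Longrightarrow> y \<in> A i \<Longrightarrow> x = y"
  using p2p3[of "v (i + 2)" "v (i + 3)" x "v i" y] by (auto simp: to_v)

lemma A_A2: "x \<in> A i \<Longrightarrow> y \<in> A (i + 2) \<Longrightarrow> E x y"
  using p2p3[of "v (i + 2)" y "v (i + 4)" "v i" x] v_notin_A[of "i + 4" i]
  by (auto simp: to_v adj_comm[of y x])

lemma A_P2: "x \<in> A i \<Longrightarrow> y \<in> B (i + 2) \<Longrightarrow> E x y"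
  using p2p3[of x "v i" "v (i + 2)" "v (i + 3)" y]
  by (auto simp: to_v dest!: B_D)

lemma A_P3: "x \<in> A i \<Longrightarrow> y \<in> B (i + 3) \<Longrightarrow> E x y"
  using p2p3[of x "v i" "v (i + 3)" "v (i + 2)" y]
  by (auto simp: to_v dest!: B_D)

lemma AZ: "x \<in> A i \<Longrightarrow> z \<in> Z \<Longrightarrow> \<not> E x z" "x \<in> A i \<Longrightarrow> z \<in> Z \<Longrightarrow> \<not> E z x"
  using p2p3[of x z "v (i + 1)" "v (i + 2)" "v (i + 3)"] inj_v
  by (auto simp: to_v inj_eq adj_comm[of z x])

lemma ZZ: "x \<in> Z \<Longrightarrow> z \<in> Z \<Longrightarrow> \<not> E x z"
  using p2p3[of x z "v 0" "v 1" "v 2"] inj_v by (auto simp: to_v inj_eq)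

text \<open>With \<open>P_unique\<close>, the edges between \<open>Z\<close> and a part
  \<open>P i\<close> form a matching: a path centred in one of them would be unattached to the edge
  from \<open>v (i + 2)\<close> to \<open>v (i + 3)\<close>.\<close>

lemma Z_unique: "x \<in> P i \<Longrightarrow> z \<in> Z \<Longrightarrow> w \<in> Z \<Longrightarrow> E x z \<Longrightarrow> E x w \<Longrightarrow> z = w"
  using p2p3[of "v (i + 2)" "v (i + 3)" z x w] by (auto simp: to_v adj_comm[of z x])

lemma P_unique: "x \<in> P i \<Longrightarrow> y \<in> P i \<Longrightarrow> z \<in> Z \<Longrightarrow> E z x \<Longrightarrow> E z y \<Longrightarrow> x = y"
  using p2p3[of "v (i + 2)" "v (i + 3)" x z y] by (auto simp: to_v adj_comm[of x z])

text \<open>The edge \<open>z x\<close> must be attached to the path from \<open>v (i + 2)\<close>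
  over \<open>v (i + 3)\<close> to \<open>y\<close>, and \<open>z y\<close> is the only possibility.
  Adjacency to \<open>z\<close> thus spreads to the sets two steps away.\<close>

lemma Z_complete2: "z \<in> Z \<Longrightarrow> x \<in> P i \<Longrightarrow> E z x \<Longrightarrow> y \<in> B (i + 2) \<Longrightarrow> E z y"
  using p2p3[of z x "v (i + 2)" "v (i + 3)" y] PP[of x i y "i + 2"]
  by (auto simp: to_v dest!: B_D[where j = "i + 2"])

lemma Z_complete3: "z \<in> Z \<Longrightarrow> x \<in> P i \<Longrightarrow> E z x \<Longrightarrow> y \<in> B (i + 3) \<Longrightarrow> E z y"
  using p2p3[of z x "v (i + 3)" "v (i + 2)" y] PP[of x i y "i + 3"]
  by (auto simp: to_v dest!: B_D[where j = "i + 3"])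

text \<open>With its mirror image, the missing edges between consecutive parts form a matching: two
  missing at \<open>x\<close> leave the path \<open>y\<close>, \<open>v (i + 2)\<close>,
  \<open>w\<close> unattached to the edge from \<open>x\<close> to \<open>v (i + 4)\<close>.\<close>

lemma P_almost_complete:
  "x \<in> P i \<Longrightarrow> y \<in> P (i + 1) \<Longrightarrow> w \<in> P (i + 1) \<Longrightarrow> \<not> E x y \<Longrightarrow> \<not> E x w \<Longrightarrow> y = w"
  using p2p3[of x "v (i + 4)" y "v (i + 2)" w] by (auto simp: to_v)

lemma P_almost_complete':
  "x \<in> P (i + 1) \<Longrightarrow> y \<in> P i \<Longrightarrow> w \<in> P i \<Longrightarrow> \<not> E y x \<Longrightarrow> \<not> E w x \<Longrightarrow> y = w"
  using p2p3[of x "v (i + 2)" y "v (i + 4)" w]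
  by (auto simp: to_v adj_comm[of x y] adj_comm[of x w])

text \<open>With its converse, a nonadjacent pair from consecutive parts has the same neighbours in
  \<open>Z\<close>; this is the source of the bijection between nonadjacent pairs and
  \<open>T\<close>.\<close>

lemma Z_nonadj: "x \<in> P i \<Longrightarrow> y \<in> P (i + 1) \<Longrightarrow> \<not> E x y \<Longrightarrow> z \<in> Z \<Longrightarrow> E z x \<Longrightarrow> E z y"
  using p2p3[of z x "v i" y "v (i + 2)"] inj_v by (auto simp: to_v inj_eq)

lemma Z_nonadj': "x \<in> P i \<Longrightarrow> y \<in> P (i + 1) \<Longrightarrow> \<not> E x y \<Longrightarrow> z \<in> Z \<Longrightarrow> E z y \<Longrightarrow> E z x"
  using p2p3[of z y "v (i + 1)" x "v (i + 4)"] inj_v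
  by (auto simp: to_v inj_eq adj_comm[of y x])

lemma Z_hits_B: "z \<in> Z \<Longrightarrow> x \<in> P i \<Longrightarrow> E z x \<Longrightarrow> x \<in> B i"
  unfolding B_def using Z_v by auto

lemma Z_nbr: "z \<in> Z \<Longrightarrow> E z x \<Longrightarrow> \<exists>i. x \<in> B i"
  using V_cases[of x] ZZ[of z x] AZ(2)[of x _ z] Z_hits_B adj_in adj_sym by blast

section \<open>Dihedral symmetry of the cycle\<close>

lemma rotate: "cycle_graph V E (\<lambda>j. v (j + k))"
proof
  show "inj (\<lambda>j. v (j + k))" using inj_v by (auto simp: inj_on_def inj_eq[OF inj_v])
  show "E (v (i + k)) (v (j + k)) \<longleftrightarrow> j = i + 1 \<or> i = j + 1" for i j
    unfolding cyc by (auto simp: algebra_simps)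
qed

text \<open>The bounds use \<open>k = 1\<close>, which swaps the indices 0 and 1, swaps 2 and 4, and
  fixes 3.\<close>

lemma reflect: "cycle_graph V E (\<lambda>j. v (k - j))"
proof
  show "inj (\<lambda>j. v (k - j))" using inj_v by (auto simp: inj_on_def inj_eq[OF inj_v])
  show "E (v (k - i)) (v (k - j)) \<longleftrightarrow> j = i + 1 \<or> i = j + 1" for i j
    unfolding cyc by (auto simp: algebra_simps)
qed

lemma rotate_sets:
  "cycle_graph.P V E (\<lambda>j. v (j + k)) i = P (i + k)"
  "cycle_graph.A V E (\<lambda>j. v (j + k)) i = A (i + k)"
  "cycle_graph.B V E (\<lambda>j. v (j + k)) i = B (i + k)"
  "cycle_graph.Z V E (\<lambda>j. v (j + k)) = Z"
proof -
  interpret r: cycle_graph V E "\<lambda>j. v (j + k)" by (rule rotate)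
  have all: "(\<forall>j. Q j) \<longleftrightarrow> (\<forall>j. Q (j + k))" for Q :: "5 \<Rightarrow> bool"
    by (metis diff_add_cancel)
  show P: "r.P i = P (i + k)" for i
    unfolding P_def r.P_def by (subst (2) all) (auto simp: algebra_simps)
  show "r.A i = A (i + k)" unfolding A_def r.A_def by (subst (2) all) auto
  show "r.B i = B (i + k)" unfolding B_def r.B_def P by simp
  show "r.Z = Z" unfolding Z_def r.Z_def by (subst (2) all) auto
qed

lemma reflect_sets:
  "cycle_graph.P V E (\<lambda>j. v (k - j)) i = P (k - i)"
  "cycle_graph.A V E (\<lambda>j. v (k - j)) i = A (k - i)"
  "cycle_graph.B V E (\<lambda>j. v (k - j)) i = B (k - i)"
  "cycle_graph.Z V E (\<lambda>j. v (k - j)) = Z"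
proof -
  interpret r: cycle_graph V E "\<lambda>j. v (k - j)" by (rule reflect)
  have all: "(\<forall>j. Q j) \<longleftrightarrow> (\<forall>j. Q (k - j))" for Q :: "5 \<Rightarrow> bool"
    by (metis diff_diff_eq2 add_diff_cancel_left')
  have neg: "k - j = k - i + 1 \<longleftrightarrow> j = i + 4" "k - j = k - i + 4 \<longleftrightarrow> j = i + 1" for i j
    using rel_5[of j i] by auto
  show P: "r.P i = P (k - i)" for i
    unfolding P_def r.P_def by (subst (2) all) (auto simp: neg)
  show "r.A i = A (k - i)" unfolding A_def r.A_def by (subst (2) all) auto
  show "r.B i = B (k - i)" unfolding B_def r.B_def P by simp
  show "r.Z = Z" unfolding Z_def r.Z_def by (subst (2) all) auto
qed

end

section \<open>Covers of all but a few cliques by Koenig's theorem\<close>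

context p2p3_graph
begin

text \<open>The common recipe: pay \<open>k\<close> cliques for \<open>X\<close>, and let Koenig's
  theorem cover the bipartite rest. The sides may overlap and may stick out of
  \<open>W\<close>.\<close>

lemma split_cover:
  assumes "W \<subseteq> V" "W \<subseteq> X \<union> L \<union> R" "clique_cover E X k" "stable E L" "stable E R"
    and "stability_le E W a"
  shows "clique_cover E W (a + k)"
proof -
  have "clique_cover E ((L \<inter> W) \<union> ((R - L) \<inter> W)) a"
    by (rule koenig_parts) (use assms in \<open>auto intro: stable_subset stability_le_mono\<close>)
  from clique_cover_union[OF this assms(3)] show ?thesis
    by (rule clique_cover_mono) (use assms(2) in auto)
qed

end

section \<open>Three cliques whose removal leaves a bipartite graph\<close>

context cycle_graph
begin

lemma AA_cover: "clique_cover E (A i \<union> A (i + 2)) 1"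
  by (rule clique_cover_one) (use A_unique A_A2 adj_sym in blast)

lemma vA_cover: "clique_cover E ({v i} \<union> A i) 1"
  by (rule clique_cover_one) (use A_unique A_v A_v' in blast)

lemmas no_edge = PP AP PA AA AZ[THEN notE] ZZ[THEN notE]

text \<open>Once the edge \<open>v 2\<close>, \<open>v 3\<close> is gone, \<open>B 2\<close> and
  \<open>B 3\<close> can share a side, joined by \<open>P 0\<close>, which is two steps from both.
  \<open>A 0\<close> can see only \<open>P 0\<close>, \<open>P 2\<close>, \<open>P 3\<close> and
  joins \<open>P 1\<close> and \<open>P 4\<close>; the other four sets \<open>A i\<close> make up
  two cliques.\<close>

lemma cover_no_S2_at_2:
  assumes "\<And>z x. z \<in> Z \<Longrightarrow> \<not> E z x" "\<And>x y. x \<in> B 2 \<Longrightarrow> y \<in> B 3 \<Longrightarrow> \<not> E x y" "stability_le E V a"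
  shows "clique_cover E V (a + 3)"
proof -
  let ?X = "{v 2, v 3} \<union> ((A 1 \<union> A (1 + 2)) \<union> (A 2 \<union> A (2 + 2)))"
  let ?L = "P 0 \<union> B 2 \<union> B 3" and ?R = "P 4 \<union> P 1 \<union> A 0 \<union> Z"
  have "clique_cover E {v 2, v 3} 1" by (rule clique_cover_one) (auto simp: vv)
  then have X: "clique_cover E ?X (1 + (1 + 1))" by (intro clique_cover_union AA_cover)
  have L: "stable E ?L"
    unfolding stable_def using assms(2) adj_sym by (auto dest: PP PP[OF B_P] PP[OF _ B_P] PP[OF B_P B_P])
  have Z: "\<not> E z x" "\<not> E x z" if "z \<in> Z" for x z using assms(1) that adj_sym by blast+
  have R: "stable E ?R"
    unfolding stable_def using Z by (auto dest: no_edge)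
  have "V \<subseteq> ?X \<union> ?L \<union> ?R" using V_eq P_eq[of 2] P_eq[of 3] by auto
  from split_cover[OF subset_refl this X L R assms(3)] show ?thesis by (simp add: numeral_3_eq_3)
qed

lemma cover_no_S2:
  assumes "\<And>z x. z \<in> Z \<Longrightarrow> \<not> E z x" "\<And>x y. x \<in> B k \<Longrightarrow> y \<in> B (k + 1) \<Longrightarrow> \<not> E x y"
    "stability_le E V a"
  shows "clique_cover E V (a + 3)"
\<comment> \<open>Modulo 5, \<open>2 + (k + 3)\<close> is \<open>k\<close>.\<close>
proof (rule cycle_graph.cover_no_S2_at_2[OF rotate[of "k + 3"]])
  show "\<not> E x y" if "x \<in> cycle_graph.B V E (\<lambda>j. v (j + (k + 3))) 2"
    "y \<in> cycle_graph.B V E (\<lambda>j. v (j + (k + 3))) 3" for x y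
    using assms(2)[of x y] that by (simp add: rotate_sets add.commute)
qed (use assms in \<open>auto simp: rotate_sets\<close>)

text \<open>Vertices of \<open>Z\<close> can see only the sets \<open>B i\<close>; if these all lie
  on one side, \<open>Z\<close> fits on the other, with or without edges to them.\<close>

lemma cover_B_stable:
  assumes "\<And>i x y. x \<in> B i \<Longrightarrow> y \<in> B (i + 1) \<Longrightarrow> \<not> E x y" "stability_le E V a"
  shows "clique_cover E V (a + 3)"
proof -
  let ?X = "{v 3, v 4} \<union> (({v 1} \<union> A 1) \<union> (A 0 \<union> A (0 + 2)))"
  let ?L = "\<Union>j. B j" and ?R = "{v 0, v 2} \<union> A 3 \<union> A 4 \<union> Z"
  have "clique_cover E {v 3, v 4} 1" by (rule clique_cover_one) (auto simp: vv)
  then have X: "clique_cover E ?X (1 + (1 + 1))" by (intro clique_cover_union AA_cover vA_cover)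
  have L: "stable E ?L" unfolding stable_def
  proof (intro ballI notI)
    fix x y assume xy: "x \<in> ?L" "y \<in> ?L" "E x y"
    then obtain i j where ij: "x \<in> B i" "y \<in> B j" by blast
    then have "j = i + 1 \<or> j = i + 4" using PP B_P xy(3) by blast
    then show False using assms(1)[OF ij(1), of y] assms(1)[OF ij(2), of x] ij xy(3) adj_sym by auto
  qed
  have R: "stable E ?R"
    unfolding stable_def by (auto simp: to_v dest: no_edge)
  have "V \<subseteq> ?X \<union> ?L \<union> ?R"
    using V_eq P_eq[of 0] P_eq[of 1] P_eq[of 2] P_eq[of 3] P_eq[of 4] by auto
  from split_cover[OF subset_refl this X L R assms(2)] show ?thesis by (simp add: numeral_3_eq_3)
qed

text \<open>\<open>K\<close> is the exceptional vertex of \<open>Z\<close>, if any, that sees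
  \<open>P 1\<close> or \<open>P 4\<close>; it costs one clique, and the rest of \<open>Z\<close>
  shares the side of \<open>P 1\<close> and \<open>P 4\<close>.\<close>

lemma cover_two_gaps:
  assumes "B 2 = {}" "B 3 = {}" "\<And>x y. x \<in> K \<Longrightarrow> y \<in> K \<Longrightarrow> x = y"
    "\<And>z x. z \<in> Z - K \<Longrightarrow> x \<in> P 1 \<union> P 4 \<Longrightarrow> \<not> E z x" "stability_le E V a"
  shows "clique_cover E V (a + 3)"
proof -
  let ?X = "K \<union> (({v 3} \<union> A 3) \<union> (A 2 \<union> A (2 + 2)))"
  let ?L = "P 0 \<union> {v 2} \<union> A 1" and ?R = "P 1 \<union> P 4 \<union> (Z - K) \<union> A 0"
  have "clique_cover E K 1" by (rule clique_cover_one) (use assms(3) in blast)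
  then have X: "clique_cover E ?X (1 + (1 + 1))" by (intro clique_cover_union AA_cover vA_cover)
  have L: "stable E ?L"
    unfolding stable_def by (auto simp: to_v dest: no_edge)
  have Z: "\<not> E z x" "\<not> E x z" if "z \<in> Z" "z \<notin> K" "x \<in> P 1 \<or> x \<in> P 4" for x z
    using assms(4) that adj_sym by blast+
  have R: "stable E ?R"
    unfolding stable_def using Z by (auto dest: no_edge)
  have "V \<subseteq> ?X \<union> ?L \<union> ?R"
    using V_eq P_eq[of 2] P_eq[of 3] assms(1,2) by auto
  from split_cover[OF subset_refl this X L R assms(5)] show ?thesis by (simp add: numeral_3_eq_3)
qed

text \<open>By \<open>Z_complete2\<close> and \<open>Z_complete3\<close>, adjacency to
  \<open>z\<close> travels around the circle 0, 2, 4, 1, 3 of indices as long as the sets are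
  nonempty. It must not reach both \<open>b0\<close> and \<open>b1\<close>, which would close a
  triangle; so both arcs from 0 to 1, through 3 and through 2 and 4, are interrupted.\<close>

lemma S2_gaps:
  assumes b: "b0 \<in> B 0" "b1 \<in> B 1" "E b0 b1" and z: "z \<in> Z" "E z x"
  shows "B 3 = {} \<and> (B 2 = {} \<or> B 4 = {})"
proof -
  have notboth: "\<not> (E z b0 \<and> E z b1)" using b(3) tri by blast
  have complete: "E z w" if "E z y" "y \<in> B i" "w \<in> B j" "j = i + 2 \<or> j = i + 3" for i j y w
    using Z_complete2[OF z(1) B_P[OF that(2)] that(1)] Z_complete3[OF z(1) B_P[OF that(2)] that(1)] that(3,4)
    by metis
  have from2: "E z b0" if "y \<in> B 2" "E z y" for y using complete[OF that(2,1) b(1)] by simp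
  have from4: "E z b1" if "y \<in> B 4" "E z y" for y using complete[OF that(2,1) b(2)] by simp
  have n3: "\<not> E z y" if "y \<in> B 3" for y
  proof
    assume "E z y"
    then show False
      using complete[OF _ that b(1)] complete[OF _ that b(2)] notboth by simp
  qed
  obtain i where i: "x \<in> B i" using Z_nbr[OF z] by blast
  then consider "x \<in> B 0" | "x \<in> B 1" | "x \<in> B 2" | "x \<in> B 4" using cases_5[of i] n3[of x] z(2) by blast
  then obtain y where y: "E z y" "y \<in> B 0 \<or> y \<in> B 1"
    by cases (use z(2) from2 from4 b in blast)+
  have B3: "B 3 = {}"
    using y(2) complete[OF y(1), of 0 _ 3] complete[OF y(1), of 1 _ 3] n3 by auto
  have "\<not> (w \<in> B 2 \<and> u \<in> B 4)" for w u
  proof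
    assume w: "w \<in> B 2 \<and> u \<in> B 4"
    from y(2) show False
    proof
      assume "y \<in> B 0"
      then have "E z w" using complete[OF y(1), of 0 w 2] w by simp
      then show False using complete[of w 2 u 4] w from2[of w] from4[of u] notboth by simp
    next
      assume "y \<in> B 1"
      then have "E z u" using complete[OF y(1), of 1 u 4] w by simp
      then show False using complete[of u 4 w 2] w from2[of w] from4[of u] notboth by simp
    qed
  qed
  then show ?thesis using B3 by blast
qed

lemma cover_S2_gap:
  assumes b: "b0 \<in> B 0" "b1 \<in> B 1" "E b0 b1" and B4: "B 4 \<noteq> {}" and gaps: "B 2 = {}" "B 3 = {}"
    and a: "stability_le E V a"
  shows "clique_cover E V (a + 3)"
proof (rule cover_two_gaps[OF gaps _ _ a])
  let ?K = "{z \<in> Z. \<exists>x \<in> P 1 \<union> P 4. E z x}"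
  \<comment> \<open>One fixed vertex of \<open>B 4\<close> is seen by every vertex of
    \<open>?K\<close>, so \<open>Z_unique\<close> leaves at most one such vertex.\<close>
  from B4 obtain b4 where b4: "b4 \<in> B 4" by blast
  have "E z b4" if z: "z \<in> ?K" for z
  proof -
    from z obtain x where x: "z \<in> Z" "x \<in> P 1 \<union> P 4" "E z x" by blast
    show ?thesis
    proof (cases "x \<in> P 1")
      case True
      then show ?thesis using Z_complete3[of z x 1 b4] x b4 by simp
    next
      case False
      then have x4: "x \<in> P 4" using x by blast
      then have "E z b1" using Z_complete2[of z x 4 b1] x b by simp
      then show ?thesis using Z_complete3[of z b1 1 b4] x b4 b B_P by simp
    qed
  qed
  then show "x = y" if "x \<in> ?K" "y \<in> ?K" for x y
    using Z_unique[OF B_P[OF b4], of x y] that adj_sym by blast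
qed blast

end

section \<open>All five sets B linked by edges: the bound 3a/2 - 1\<close>

context cycle_graph
begin

lemma cycle_pairs_cover:
  assumes "\<And>j. b j \<in> B j"
  shows "clique_cover E (range v \<union> range b) 5"
proof -
  have pair: "clique_cover E {v i, b (i + 1)} 1" for i
    by (rule clique_cover_one)
      (use P_v[OF B_P[OF assms], of "i + 1" i] adj_sym in auto)
  have "clique_cover E ({v 0, b (0 + 1)} \<union> ({v 1, b (1 + 1)} \<union> ({v 2, b (2 + 1)} \<union>
    ({v 3, b (3 + 1)} \<union> {v 4, b (4 + 1)})))) (1 + (1 + (1 + (1 + 1))))"
    by (intro clique_cover_union pair)
  moreover have "range v \<union> range b = {v 0, b (0 + 1)} \<union> ({v 1, b (1 + 1)} \<union> ({v 2, b (2 + 1)} \<union>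
    ({v 3, b (3 + 1)} \<union> {v 4, b (4 + 1)})))"
    by (auto simp: UNIV_5)
  ultimately show ?thesis by (simp add: eval_nat_numeral)
qed

lemma card_P: "card (P j) = card (B j) + 1"
  unfolding P_eq using v_notin_B by simp

lemma stable_P2: "(\<And>z x. z \<in> Z \<Longrightarrow> \<not> E z x) \<Longrightarrow> stable E (P i \<union> P (i + 2) \<union> Z)"
  unfolding stable_def using adj_sym by (auto dest: PP)

text \<open>The 2 counts the cycle vertices \<open>v i\<close> and \<open>v (i + 2)\<close>.\<close>

lemma card_P2_Z:
  assumes "\<And>z x. z \<in> Z \<Longrightarrow> \<not> E z x" "stability_le E V a"
  shows "card (B i) + card (B (i + 2)) + card Z + 2 \<le> a"
proof -
  have "card (P i \<union> P (i + 2) \<union> Z) \<le> a"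
    using assms(2) stable_P2[OF assms(1), of i] sub_V unfolding stability_le_def by (meson Un_least)
  moreover have "P i \<inter> P (i + 2) = {}" "(P i \<union> P (i + 2)) \<inter> Z = {}"
    using disj_PP[of _ i "i + 2"] disj_other(3) by auto
  ultimately show ?thesis by (simp add: card_Un_disjoint card_P)
qed

text \<open>Removing \<open>P i\<close> cuts the ring of five parts open into a path of four, which
  is bipartite; the vertices of \<open>P i\<close> are paid for one by one.\<close>

lemma cover_after_P:
  assumes Z: "\<And>z x. z \<in> Z \<Longrightarrow> \<not> E z x" and A: "\<And>j. A j = {}"
    and W: "W \<subseteq> V" "stability_le E W a"
  shows "clique_cover E W (a + card (P i \<inter> W))"
proof (rule split_cover[OF W(1) _ clique_cover_card _ _ W(2)])
  have Z': "\<not> E x z" if "z \<in> Z" for x z using Z that adj_sym by blast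
  show "W \<subseteq> (P i \<inter> W) \<union> (P (i + 1) \<union> P (i + 3) \<union> Z) \<union> (P (i + 2) \<union> P (i + 4))"
  proof
    fix x assume "x \<in> W"
    then consider "x \<in> Z" | j where "x \<in> P j" using V_cases A W(1) by blast
    then show "x \<in> (P i \<inter> W) \<union> (P (i + 1) \<union> P (i + 3) \<union> Z) \<union> (P (i + 2) \<union> P (i + 4))"
    proof cases
      case 2
      then show ?thesis using \<open>x \<in> W\<close> rel_5[of j i] by auto
    qed blast
  qed
  show "stable E (P (i + 1) \<union> P (i + 3) \<union> Z)"
    unfolding stable_def using Z Z' by (auto dest: PP)
  show "stable E (P (i + 2) \<union> P (i + 4))"
    unfolding stable_def by (auto dest: PP)
qed simp

text \<open>\<open>y\<close> misses at most one vertex of \<open>B (i + 2)\<close>, so it keeps a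
  neighbour \<open>d\<close> there. If \<open>x y\<close> were missing, the edge from
  \<open>x\<close> to \<open>v (i + 4)\<close> and the path \<open>d\<close>, \<open>y\<close>,
  \<open>v (i + 2)\<close> would be unattached.\<close>

lemma complete_P:
  assumes "x \<in> P i" "y \<in> P (i + 1)" "card (B (i + 2)) \<ge> 2"
  shows "E x y"
proof (rule ccontr)
  assume n: "\<not> E x y"
  from assms(3) obtain c c' where c: "c \<in> B (i + 2)" "c' \<in> B (i + 2)" "c \<noteq> c'"
    by (metis One_nat_def card.empty card_le_Suc0_iff_eq fin_parts(4) not_less_eq_eq numeral_2_eq_2 zero_le)
  have "\<exists>c\<in>B (i + 2). E y c"
    using P_almost_complete[OF assms(2), of c c'] c B_P by (force simp: add.assoc)
  then obtain d where d: "d \<in> B (i + 2)" "E y d" by blast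
  show False
    using p2p3[of x "v (i + 4)" d y "v (i + 2)"] n assms(1,2) d(2) B_P[OF d(1)] v_notin_B d(1)
      PP[OF assms(1) B_P[OF d(1)]]
    by (auto simp: to_v adj_comm[of d y])
qed

text \<open>The inequality is \<open>k \<le> 3 * a / 2 - 1\<close> without fractions. In the main
  case the count is 5 edges, then \<open>a - 4\<close> by Koenig's theorem, then at most half of
  \<open>a - 4\<close> for the deleted part, which is exactly this bound.\<close>

lemma cover_all_B_edges:
  assumes Z: "\<And>z x. z \<in> Z \<Longrightarrow> \<not> E z x" and A: "\<And>j. A j = {}"
    and edges: "\<And>j. \<exists>x\<in>B j. \<exists>y\<in>B (j + 1). E x y" and a: "stability_le E V a"
  shows "\<exists>k. clique_cover E V k \<and> 2 * k + 2 \<le> 3 * a"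
proof -
  have sum: "card (B i) + card (B (i + 2)) + card Z + 2 \<le> a" for i
    using card_P2_Z[OF Z a] .
  have pos: "card (B i) \<ge> 1" for i
    using edges[of i] by (auto simp: Suc_le_eq card_gt_0_iff)
  have a4: "a \<ge> 4" using sum[of 0] pos[of 0] pos[of "0 + 2"] by linarith
  have V_sub: "V \<subseteq> Z \<union> (\<Union>j. P j)"
  proof
    show "x \<in> Z \<union> (\<Union>j. P j)" if "x \<in> V" for x using V_cases[OF that] A by auto
  qed
  \<comment> \<open>A one-element \<open>B i\<close> gives a cover by \<open>a + 2\<close> cliques,
    which is good enough from \<open>a = 6\<close> on; hence the separate case of small
    \<open>a\<close>.\<close>
  consider "\<forall>i. card (B i) \<ge> 2" | i where "card (B i) = 1" "a \<ge> 6" | "a \<le> 5"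
  proof (cases "\<forall>i. card (B i) \<ge> 2")
    case False
    then obtain i where "\<not> card (B i) \<ge> 2" by blast
    then have "card (B i) = 1" using pos[of i] by linarith
    then show ?thesis using that(2)[of i] that(3) by linarith
  qed (rule that(1))
  then show ?thesis
  proof cases
    case 1
    have complete: "E x y" if "x \<in> P i" "y \<in> P (i + 1)" for i x y
      using complete_P that 1 by blast
    have "\<forall>j. \<exists>x. x \<in> B j" using edges by blast
    then obtain b where b: "\<And>j. b j \<in> B j" by metis
    \<comment> \<open>The ten removed vertices, two from each part, are matched into five edges
      \<open>v j\<close>, \<open>b (j + 1)\<close>.\<close>
    let ?W = "V - (range v \<union> range b)"
    have le: "stability_le E ?W (a - 4)" unfolding stability_le_def
    proof (intro allI impI)
      fix S assume S: "S \<subseteq> ?W" "stable E S"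
      \<comment> \<open>Consecutive parts are complete to each other, so a stable set lives in
        \<open>Z\<close> and two parts at distance two; the four removed vertices of these parts can
        be added to it, which explains \<open>a - 4\<close>.\<close>
      have "\<not> (S \<inter> P j \<noteq> {} \<and> S \<inter> P (j + 1) \<noteq> {})" for j
        using complete[of _ j] S(2) unfolding stable_def by blast
      from this[of 0] this[of 1] this[of 2] this[of 3] this[of 4]
      have "\<exists>i. \<forall>j. S \<inter> P j \<noteq> {} \<longrightarrow> j = i \<or> j = i + 2"
        unfolding ex_5 all_5
        by (cases "S \<inter> P 0 = {}"; cases "S \<inter> P 1 = {}"; cases "S \<inter> P 2 = {}";
            cases "S \<inter> P 3 = {}"; cases "S \<inter> P 4 = {}") simp_all
      then obtain i where i: "\<And>j. S \<inter> P j \<noteq> {} \<Longrightarrow> j = i \<or> j = i + 2" by blast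
      let ?T = "{v i, b i, v (i + 2), b (i + 2)}"
      have "S \<subseteq> P i \<union> P (i + 2) \<union> Z" using S(1) V_sub i by blast
      then have "S \<union> ?T \<subseteq> P i \<union> P (i + 2) \<union> Z" using v_P b B_P by auto
      then have "card (S \<union> ?T) \<le> a"
        using a stable_subset[OF stable_P2[OF Z]] sub_V unfolding stability_le_def
        by (meson Un_least subset_trans)
      moreover have "S \<inter> ?T = {}" using S(1) by auto
      moreover have "finite S" using S(1) fin finite_subset by blast
      moreover have "card ?T = 4"
      proof -
        have "v i \<noteq> v (i + 2)" using inj_v by (auto simp: inj_eq)
        moreover have "v j \<noteq> b k" "b k \<noteq> v j" for j k using v_notin_B[of j k] b[of k] by metis+
        moreover have "b i \<noteq> b (i + 2)"
          using disj_PP[OF B_P[OF b[of i]], of "i + 2"] B_P[OF b[of "i + 2"]] by auto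
        ultimately show ?thesis by auto
      qed
      ultimately have "card S + 4 \<le> a"
        by (metis card_Un_disjoint finite.emptyI finite.insertI)
      then show "card S \<le> a - 4" by simp
    qed
    \<comment> \<open>What is left of \<open>P 0\<close> and \<open>P 2\<close> is stable together,
      so the smaller of the two has at most half of \<open>a - 4\<close> vertices.\<close>
    have dis: "P 0 \<inter> P 2 = {}" using disj_PP[of _ 0 2] by auto
    have "stable E (P 0 \<union> P 2 \<union> Z)" using stable_P2[OF Z, of 0] by simp
    then have "stable E ((P 0 \<inter> ?W) \<union> (P 2 \<inter> ?W))" by (rule stable_subset) blast
    then have "card ((P 0 \<inter> ?W) \<union> (P 2 \<inter> ?W)) \<le> a - 4"
      using le unfolding stability_le_def by (meson Un_least inf_le2)
    then have "card (P 0 \<inter> ?W) + card (P 2 \<inter> ?W) \<le> a - 4"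
      using dis by (subst (asm) card_Un_disjoint) auto
    then obtain i where i: "2 * card (P i \<inter> ?W) \<le> a - 4"
      using that[of 0] that[of 2] by linarith
    have "clique_cover E ?W (a - 4 + card (P i \<inter> ?W))"
      by (rule cover_after_P[OF Z A _ le]) auto
    from clique_cover_union[OF cycle_pairs_cover[OF b] this]
    have "clique_cover E V (5 + (a - 4 + card (P i \<inter> ?W)))"
      by (rule clique_cover_mono) auto
    moreover have "2 * (5 + (a - 4 + card (P i \<inter> ?W))) + 2 \<le> 3 * a"
      using i a4 by arith
    ultimately show ?thesis by blast
  next
    case (2 i)
    have "clique_cover E V (a + card (P i \<inter> V))"
      by (rule cover_after_P[OF Z A _ a]) auto
    moreover have "card (P i \<inter> V) = 2" using 2 card_P sub_V(1) by (simp add: Int_absorb2)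
    ultimately show ?thesis using 2(2) by (intro exI[of _ "a + 2"]) auto
  next
    case 3
    have n: "card (B 0) \<ge> 1" "card (B 1) \<ge> 1" "card (B 2) \<ge> 1" "card (B 3) \<ge> 1" "card (B 4) \<ge> 1"
      using pos by blast+
    have s: "card (B 0) + card (B 2) + card Z + 2 \<le> a" "card (B 1) + card (B 3) + card Z + 2 \<le> a"
      "card (B 2) + card (B 4) + card Z + 2 \<le> a" "card (B 3) + card (B 0) + card Z + 2 \<le> a"
      "card (B 4) + card (B 1) + card Z + 2 \<le> a"
      using sum[of 0] sum[of 1] sum[of 2] sum[of 3] sum[of 4] by simp_all
    \<comment> \<open>With \<open>a \<le> 5\<close>, two sets \<open>B j\<close> of size at least
      two cannot be two steps apart, so all such sets lie in one consecutive pair.\<close>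
    have "\<exists>i. \<forall>j. j \<noteq> i \<and> j \<noteq> i + 1 \<longrightarrow> card (B j) = 1"
      unfolding ex_5 all_5 using n s 3 by simp linarith
    then obtain i where i: "\<And>j. j \<noteq> i \<Longrightarrow> j \<noteq> i + 1 \<Longrightarrow> card (B j) = 1" by blast
    obtain x y where xy: "x \<in> B i" "y \<in> B (i + 1)" "E x y" using edges by blast
    have two: "card (B j) + card Z \<le> a - 3" for j
      using sum[of j] pos[of "j + 2"] by linarith
    \<comment> \<open>In a two-element \<open>B j\<close> the representative is chosen so that the
      leftover vertex is an end of the edge \<open>x y\<close>.\<close>
    have "\<exists>w. w \<in> B j \<and> (\<forall>u\<in>B j. u = w \<or> card Z = 0 \<and> a = 5 \<and> (u = x \<or> u = y))" for j
    proof (cases "card (B j) = 1")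
      case True
      then show ?thesis by (auto simp: card_1_singleton_iff)
    next
      case False
      then have c2: "card (B j) = 2" "a = 5" "card Z = 0" using two[of j] pos[of j] 3 by linarith+
      obtain u where u: "u \<in> B j" "u = x \<or> u = y" using i[of j] False xy by blast
      obtain w w' where w: "B j = {w, w'}" using c2(1) by (auto simp: card_2_iff)
      then show ?thesis using u c2 by (cases "u = w") auto
    qed
    then obtain b where b: "\<And>j. b j \<in> B j"
      "\<And>j u. u \<in> B j \<Longrightarrow> u = b j \<or> card Z = 0 \<and> a = 5 \<and> (u = x \<or> u = y)" by metis
    \<comment> \<open>What the ten vertices may leave over: the edge \<open>x y\<close> or one
      vertex of \<open>Z\<close> if \<open>a = 5\<close>, nothing if \<open>a = 4\<close>; that is
      \<open>a - 4\<close> cliques each time.\<close>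
    let ?K = "if card Z = 0 then (if a = 5 then {x, y} else {}) else Z"
    have "clique_cover E ?K (a - 4)"
    proof (cases "card Z = 0 \<or> a = 4")
      case True
      have "clique_cover E {x, y} 1" by (rule clique_cover_one) (use xy adj_sym in auto)
      moreover have "a = 4 \<Longrightarrow> card Z = 0" using two[of 0] pos[of 0] by linarith
      ultimately show ?thesis using True by (auto simp: clique_cover_empty)
    next
      case False
      then have "a = 5" "card Z = 1" using 3 a4 two[of 0] pos[of 0] by linarith+
      then show ?thesis using clique_cover_card[of Z E] by simp
    qed
    from clique_cover_union[OF cycle_pairs_cover[OF b(1)] this]
    have "clique_cover E V (5 + (a - 4))"
    proof (rule clique_cover_mono)
      have "u \<in> range v \<union> range b \<union> ?K" if u: "u \<in> P j" for u j
      proof (cases "u = v j")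
        case False
        then have "u \<in> B j" using u unfolding B_def by blast
        then show ?thesis using b(2)[of u j] by auto
      qed auto
      moreover have "u \<in> ?K" if "u \<in> Z" for u using that by (auto simp: card_eq_0_iff)
      ultimately show "V \<subseteq> range v \<union> range b \<union> ?K" using V_sub by blast
    qed simp
    then show ?thesis using 3 a4 by (intro exI[of _ "5 + (a - 4)"]) auto
  qed
qed

end

section \<open>The case of two adjacent sets B\<close>

context cycle_graph
begin

text \<open>\<open>U i\<close> is \<open>B i\<close> without \<open>N(S\<^sub>2)\<close>, and \<open>T i\<close> is in bijection with the set of nonadjacent
  pairs \<open>M\<close>: the two vertices of such a pair have the same unique neighbour in \<open>Z\<close>.\<close>

definition U :: "5 \<Rightarrow> 'a set" where
  "U i = {x \<in> B i. \<forall>z\<in>Z. \<not> E x z}"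

definition T :: "5 \<Rightarrow> 'a set" where
  "T i = {z \<in> Z. (\<exists>x\<in>B i. E z x) \<and> (\<exists>y\<in>B (i + 1). E z y)}"

lemma fin_UT [simp]: "finite (U i)" "finite (T i)"
  unfolding U_def T_def by auto

lemma U_reflect: "cycle_graph.U V E (\<lambda>j. v (k - j)) i = U (k - i)"
proof -
  interpret r: cycle_graph V E "\<lambda>j. v (k - j)" by (rule reflect)
  show ?thesis unfolding U_def r.U_def reflect_sets by simp
qed

lemma card_A: "card (A i) \<le> 1"
  using A_unique by (simp add: card_le_Suc0_iff_eq)

text \<open>Sending a vertex of \<open>B 0\<close> to its only neighbour in \<open>Z\<close> is injective, which
  trades vertices of \<open>B 0\<close> for vertices of \<open>Z\<close> outside \<open>S\<close>.\<close>

lemma half_count: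
  assumes S: "S \<subseteq> Z \<union> B 0 \<union> {v 2} \<union> A 1 \<union> ({v 0} \<union> A 0)"
    and T1: "T1 \<subseteq> Z" "\<And>u w. u \<in> S \<Longrightarrow> u \<in> B 0 \<Longrightarrow> w \<in> S \<Longrightarrow> w \<in> Z \<Longrightarrow> E u w \<Longrightarrow> w \<in> T1"
    and A0: "\<And>u. v 0 \<in> S \<Longrightarrow> u \<in> A 0 \<Longrightarrow> u \<notin> S"
  shows "card S \<le> card Z + card (U 0) + card T1 + 2 + card (A 1)"
proof -
  let ?N = "(S \<inter> B 0) - U 0"
  have finT: "finite T1" using T1(1) by (rule finite_subset) simp
  have "\<forall>x\<in>?N. \<exists>z. z \<in> Z \<and> E x z" unfolding U_def by blast
  then obtain f where f: "\<And>x. x \<in> ?N \<Longrightarrow> f x \<in> Z \<and> E x (f x)" by metis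
  have "inj_on f ?N"
  proof (rule inj_onI)
    fix x y assume xy: "x \<in> ?N" "y \<in> ?N" "f x = f y"
    then show "x = y" using P_unique[of x 0 y "f x"] f[of x] f[of y] B_P adj_sym by auto
  qed
  moreover have "f ` ?N \<subseteq> (Z - S) \<union> T1" using f T1(2) by fastforce
  ultimately have "card ?N \<le> card ((Z - S) \<union> T1)"
    using finT by (intro card_inj_on_le) auto
  then have N: "card ?N \<le> card (Z - S) + card T1" using card_Un_le le_trans by blast
  let ?Q = "S \<inter> ({v 0} \<union> A 0)"
  have "?Q \<subseteq> {v 0} \<or> ?Q \<subseteq> A 0" using A0 by blast
  then have Q: "card ?Q \<le> 1"
    using card_mono[of "{v 0}" ?Q] card_mono[of "A 0" ?Q] card_A[of 0] by auto
  have "S \<subseteq> (Z \<inter> S) \<union> (U 0 \<union> ?N) \<union> ({v 2} \<union> A 1) \<union> ?Q" using S by blast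
  then have "card S \<le> card ((Z \<inter> S) \<union> (U 0 \<union> ?N) \<union> ({v 2} \<union> A 1) \<union> ?Q)"
    by (rule card_mono[rotated]) auto
  also have "\<dots> \<le> card (Z \<inter> S) + (card (U 0) + card ?N) + (1 + card (A 1)) + card ?Q"
    by (intro order.trans[OF card_Un_le] add_mono) auto
  finally have "card S \<le> card (Z \<inter> S) + (card (U 0) + card ?N) + (1 + card (A 1)) + card ?Q" .
  moreover have "card (Z \<inter> S) + card (Z - S) = card Z"
    by (subst card_Un_disjoint[symmetric]) (auto intro!: arg_cong[of _ _ card])
  ultimately show ?thesis using N Q by linarith
qed

text \<open>The stable set is \<open>Z \<union> U 0 \<union> {v 0, v 2} \<union> A k\<close>:
  \<open>U 0\<close> has no neighbour in \<open>Z\<close>, and \<open>A 1\<close> and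
  \<open>A 4\<close> see neither \<open>P 0\<close> nor \<open>v 2\<close>.\<close>

lemma two_B_lower:
  assumes "stability_le E V a"
  shows "card Z + card (U 0) + 2 + card (A 1) \<le> a" "card Z + card (U 0) + 2 + card (A 4) \<le> a"
proof -
  have gen: "card Z + card (U 0) + 2 + card (A k) \<le> a" if k: "k = 1 \<or> k = 4" for k
  proof -
    let ?S = "Z \<union> U 0 \<union> ({v 0, v 2} \<union> A k)"
    have U: "x \<in> B 0 \<and> (\<forall>z\<in>Z. \<not> E x z \<and> \<not> E z x)" if "x \<in> U 0" for x
      using that adj_sym unfolding U_def by blast
    then have no_UZ: "\<not> E x z" "\<not> E z x" if "x \<in> U 0" "z \<in> Z" for x z using that by blast+
    have UP: "U 0 \<subseteq> P 0" using U B_P by blast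
    note UP' = subsetD[OF UP]
    have "stable E ?S"
      unfolding stable_def using k
      by (auto simp: to_v dest: no_edge no_UZ[THEN notE] subsetD[OF UP] PP[OF UP' UP'] AP[OF _ UP'] PA[OF UP'])
    moreover have "?S \<subseteq> V" using sub_V v_in UP by blast
    ultimately have "card ?S \<le> a" using assms unfolding stability_le_def by blast
    moreover have "card ?S = card Z + card (U 0) + (2 + card (A k))"
    proof -
      have "Z \<inter> U 0 = {}" using UP disj_other by blast
      moreover have "{v 0, v 2} \<inter> A k = {}" using v_notin_A by blast
      moreover have "v 0 \<noteq> v 2" using inj_v by (auto simp: inj_eq)
      moreover have "(Z \<union> U 0) \<inter> ({v 0, v 2} \<union> A k) = {}"
        using v_notin_Z v_notin_B disj_other U UP by blast
      ultimately show ?thesis by (simp add: card_Un_disjoint del: Un_insert_left)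
    qed
    ultimately show ?thesis by simp
  qed
  show "card Z + card (U 0) + 2 + card (A 1) \<le> a" "card Z + card (U 0) + 2 + card (A 4) \<le> a"
    using gen by blast+
qed

lemma two_B_lower':
  assumes "stability_le E V a"
  shows "card Z + card (U 1) + 2 + card (A 0) \<le> a" "card Z + card (U 1) + 2 + card (A 2) \<le> a"
  using cycle_graph.two_B_lower[OF reflect[of 1] assms] by (simp_all add: reflect_sets U_reflect neg_5)

lemma half_count':
  assumes "S \<subseteq> Z \<union> B 1 \<union> {v 4} \<union> A 0 \<union> ({v 1} \<union> A 1)"
    "T1 \<subseteq> Z" "\<And>u w. u \<in> S \<Longrightarrow> u \<in> B 1 \<Longrightarrow> w \<in> S \<Longrightarrow> w \<in> Z \<Longrightarrow> E u w \<Longrightarrow> w \<in> T1"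
    "\<And>u. v 1 \<in> S \<Longrightarrow> u \<in> A 1 \<Longrightarrow> u \<notin> S"
  shows "card S \<le> card Z + card (U 1) + card T1 + 2 + card (A 0)"
proof -
  have "(1 :: 5) - 0 = 1" "(1 :: 5) - 1 = 0" "(1 :: 5) - 2 = 4" by simp_all
  note h = cycle_graph.half_count[OF reflect[of 1], of S T1, unfolded reflect_sets U_reflect this]
  show ?thesis by (rule h; fact assms)
qed

text \<open>Put the vertices of \<open>T1\<close> on the side of \<open>B 0\<close> and those of \<open>T2\<close> on the side of \<open>B 1\<close>, and
  apply Koenig's theorem after deleting the edges inside the two sides.  A set that is stable only
  after this deletion contains an edge inside one side and therefore misses the other \<open>P\<close>.\<close>

lemma two_B_cover:
  assumes B: "B 2 = {}" "B 3 = {}" "B 4 = {}" and a: "stability_le E V a" "a \<le> c"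
    and T: "T 0 = T1 \<union> T2"
    and c1: "T1 \<noteq> {} \<Longrightarrow> card Z + card (U 0) + card T1 + 2 + card (A 1) \<le> c"
    and c2: "T2 \<noteq> {} \<Longrightarrow> card Z + card (U 1) + card T2 + 2 + card (A 0) \<le> c"
  shows "clique_cover E V (c + 1 + (if A 2 \<union> A 4 = {} then 0 else 1))"
proof -
  \<comment> \<open>A vertex of \<open>Z\<close> with a neighbour in \<open>B 0\<close> goes right
    unless it is in \<open>T1\<close>, all others go left. Hence the only edges inside the sides run
    between \<open>B 0\<close> and \<open>T1\<close> and between \<open>B 1\<close> and
    \<open>T2\<close>.\<close>
  define ZL where "ZL = {z \<in> Z. (\<forall>x\<in>B 0. \<not> E z x) \<or> z \<in> T1}"
  define ZR where "ZR = Z - ZL"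
  define L where "L = P 0 \<union> {v 2} \<union> A 1 \<union> ZL"
  define R where "R = P 1 \<union> {v 4} \<union> A 0 \<union> ZR"
  define F where "F x y \<longleftrightarrow> E x y \<and> (x \<in> L \<and> y \<in> R \<or> x \<in> R \<and> y \<in> L)" for x y
  have TZ: "T1 \<subseteq> Z" "T2 \<subseteq> Z" using T unfolding T_def by auto
  have subs: "L \<subseteq> V" "R \<subseteq> V" unfolding L_def R_def ZL_def ZR_def using sub_V v_in by auto
  have "L \<subseteq> P 0 \<union> P 2 \<union> A 1 \<union> ZL" "R \<subseteq> P 1 \<union> P 4 \<union> A 0 \<union> (Z - ZL)"
    unfolding L_def R_def ZR_def using v_P by auto
  moreover have "ZL \<subseteq> Z" unfolding ZL_def by blast
  ultimately have "x \<in> P 0 \<or> x \<in> P 2 \<or> x \<in> A 1 \<or> x \<in> ZL" "x \<in> P 1 \<or> x \<in> P 4 \<or> x \<in> A 0 \<or> x \<in> Z - ZL"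
    "x \<in> ZL \<Longrightarrow> x \<in> Z" if "x \<in> L \<inter> R" for x
    using that by blast+
  then have disj: "L \<inter> R = {}"
    by (fastforce dest: disj_PP disj_AA disj_other)
  have inL: "x \<in> B 0 \<and> y \<in> T1 \<or> y \<in> B 0 \<and> x \<in> T1" if "x \<in> L" "y \<in> L" "E x y" for x y
  proof -
    have "x \<in> P 0 \<and> y \<in> ZL \<or> y \<in> P 0 \<and> x \<in> ZL"
      using that unfolding L_def ZL_def by (auto simp: to_v dest: no_edge)
    then show ?thesis using that(3) Z_hits_B adj_sym unfolding ZL_def by blast
  qed
  have inR: "x \<in> B 1 \<and> y \<in> T2 \<or> y \<in> B 1 \<and> x \<in> T2" if "x \<in> R" "y \<in> R" "E x y" for x y
  proof -
    have "x \<in> P 1 \<and> y \<in> ZR \<or> y \<in> P 1 \<and> x \<in> ZR"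
      using that unfolding R_def ZR_def by (auto simp: to_v dest: no_edge)
    moreover have "z \<in> T2" if "z \<in> ZR" "E z y" "y \<in> B 1" for z y
    proof -
      have "z \<in> T 0" using that unfolding ZR_def ZL_def T_def by auto
      then show ?thesis using T that(1) unfolding ZR_def ZL_def by blast
    qed
    ultimately show ?thesis using that(3) Z_hits_B adj_sym unfolding ZR_def by blast
  qed
  have "stability_le F (L \<union> R) c" unfolding stability_le_def
  proof (intro allI impI)
    fix S assume S: "S \<subseteq> L \<union> R" "stable F S"
    have noF: "\<not> E x y" if "x \<in> S" "y \<in> S" "x \<in> L" "y \<in> R" for x y
      using S(2) that unfolding stable_def F_def by blast
    consider "stable E S"
      | x z where "x \<in> S" "z \<in> S" "x \<in> B 0" "z \<in> T1" "E z x" "x \<in> L" "z \<in> L"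
      | x z where "x \<in> S" "z \<in> S" "x \<in> B 1" "z \<in> T2" "E z x" "x \<in> R" "z \<in> R"
    proof (cases "stable E S")
      case False
      then obtain x y where xy: "x \<in> S" "y \<in> S" "E x y" unfolding stable_def by blast
      then have "x \<in> L \<and> y \<in> L \<or> x \<in> R \<and> y \<in> R" using noF adj_sym S(1) by blast
      then show ?thesis using inL[of x y] inR[of x y] xy adj_sym that(2,3) by blast
    qed (rule that(1))
    then show "card S \<le> c"
    proof cases
      case 1
      then show ?thesis using a S(1) subs unfolding stability_le_def by (meson Un_least le_trans subset_trans)
    next
      case (2 x z)
      have x0: "x \<in> P 0" using 2 B_P by blast
      have zZ: "z \<in> Z" using 2 TZ by blast
      \<comment> \<open>Such a \<open>y\<close> would be nonadjacent to \<open>x\<close>, because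
        \<open>F\<close> keeps all edges across; \<open>Z_nonadj\<close> would then give the edge
        \<open>z y\<close>, which also runs across.\<close>
      have "y \<notin> S" if "y \<in> P 1" for y
      proof
        assume y: "y \<in> S"
        have yR: "y \<in> R" using that unfolding R_def by simp
        then have "\<not> E x y" using noF 2 y by blast
        then have "E z y" using Z_nonadj[of x 0 y z] x0 zZ that 2 by simp
        then show False using noF 2 y yR by blast
      qed
      moreover have "v 4 \<notin> S" using noF[OF 2(1) _ 2(6), of "v 4"] P_v[OF x0, of 4] unfolding R_def by auto
      ultimately have "S \<subseteq> Z \<union> B 0 \<union> {v 2} \<union> A 1 \<union> ({v 0} \<union> A 0)"
        using S(1) unfolding L_def R_def ZL_def ZR_def P_eq[of 0] by blast
      moreover have "w \<in> T1" if "u \<in> S" "u \<in> B 0" "w \<in> S" "w \<in> Z" "E u w" for u w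
      proof -
        have "u \<in> L" using that B_P unfolding L_def by blast
        then have "w \<notin> R" using noF that by blast
        then have "w \<in> ZL" using that(4) unfolding R_def ZR_def by blast
        then show ?thesis using that adj_sym unfolding ZL_def by blast
      qed
      moreover have "u \<notin> S" if "v 0 \<in> S" "u \<in> A 0" for u
        using noF[OF that(1), of u] that v_P[of 0] A_v'[of u 0 0] unfolding L_def R_def by auto
      ultimately have "card S \<le> card Z + card (U 0) + card T1 + 2 + card (A 1)"
        by (intro half_count TZ(1))
      then show ?thesis using c1 2(4) by fastforce
    next
      case (3 x z)
      have x1: "x \<in> P 1" using 3 B_P by blast
      have zZ: "z \<in> Z" using 3 TZ by blast
      have "y \<notin> S" if "y \<in> P 0" for y
      proof
        assume y: "y \<in> S"
        have yL: "y \<in> L" using that unfolding L_def by simp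
        then have "\<not> E y x" using noF 3 y by blast
        then have "E z y" using Z_nonadj'[of y 0 x z] x1 zZ that 3 by simp
        then show False using noF 3 y yL adj_sym by blast
      qed
      moreover have "v 2 \<notin> S" using noF[OF _ 3(1) _ 3(6), of "v 2"] P_v'[OF x1, of 2] unfolding L_def by auto
      ultimately have "S \<subseteq> Z \<union> B 1 \<union> {v 4} \<union> A 0 \<union> ({v 1} \<union> A 1)"
        using S(1) unfolding L_def R_def ZL_def ZR_def P_eq[of 1] by blast
      moreover have "w \<in> T2" if "u \<in> S" "u \<in> B 1" "w \<in> S" "w \<in> Z" "E u w" for u w
      proof -
        have uR: "u \<in> R" using that B_P unfolding R_def by blast
        then have "w \<notin> L" using noF that adj_sym by blast
        then have "w \<in> ZR" using that(4) unfolding L_def ZR_def by blast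
        then have "w \<in> R" unfolding R_def by blast
        moreover have "u \<notin> T2" using that(2) TZ disj_other B_P by blast
        ultimately show ?thesis using inR[OF uR _ that(5)] by blast
      qed
      moreover have "u \<notin> S" if "v 1 \<in> S" "u \<in> A 1" for u
        using noF[of u "v 1"] that v_P[of 1] A_v[of u 1 1] unfolding L_def R_def by auto
      ultimately have "card S \<le> card Z + card (U 1) + card T2 + 2 + card (A 0)"
        by (intro half_count' TZ(2))
      then show ?thesis using c2 3(4) by fastforce
    qed
  qed
  moreover have "finite L" "finite R" using subs fin finite_subset by blast+
  moreover have "stable F L" "stable F R" using disj unfolding stable_def F_def by blast+
  ultimately have "clique_cover F (L \<union> R) c"
    using disj by (intro koenig) (auto simp: F_def intro: adj_sym)
  then have LR: "clique_cover E (L \<union> R) c"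
    by (rule clique_cover_edge_mono) (simp add: F_def)
  \<comment> \<open>Counted only if present: \<open>two_B_arith\<close> relies on the fact that a
    vertex of \<open>A 2\<close> or \<open>A 4\<close> also raises a lower bound for
    \<open>a\<close>.\<close>
  have "clique_cover E (A 2 \<union> A 4) (if A 2 \<union> A 4 = {} then 0 else 1)"
    using AA_cover[of 2] by (simp add: clique_cover_empty)
  from clique_cover_union[OF clique_cover_union[OF LR vA_cover[of 3]] this]
  show ?thesis
  proof (rule clique_cover_mono)
    show "V \<subseteq> L \<union> R \<union> ({v 3} \<union> A 3) \<union> (A 2 \<union> A 4)"
      using V_eq P_eq[of 2] P_eq[of 3] P_eq[of 4] B unfolding L_def R_def ZR_def by auto
  qed simp
qed

lemma card_T: "card (T i) \<le> card Z"
  by (rule card_mono) (auto simp: T_def)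

text \<open>All of \<open>T 0\<close> goes to the side with the smaller \<open>U\<close>; the
  surplus of the other \<open>U\<close>, already counted in a lower bound for \<open>a\<close>, pays
  for it, up to one vertex of \<open>A 0\<close> or \<open>A 1\<close>.\<close>

lemma two_B_cover_unbalanced:
  assumes B: "B 2 = {}" "B 3 = {}" "B 4 = {}" and a: "stability_le E V a"
    and "card (U 0) \<ge> card (U 1) + card (T 0) \<or> card (U 1) \<ge> card (U 0) + card (T 0)"
  shows "clique_cover E V (a + 3)"
proof -
  note low = two_B_lower[OF a] two_B_lower'[OF a] card_A[of 0] card_A[of 1]
  from assms(5) have "clique_cover E V ((a + 1) + 1 + (if A 2 \<union> A 4 = {} then 0 else 1))"
  proof
    assume "card (U 0) \<ge> card (U 1) + card (T 0)"
    then show ?thesis by (intro two_B_cover[OF B a, of _ "{}" "T 0"]) (use low in auto)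
  next
    assume "card (U 1) \<ge> card (U 0) + card (T 0)"
    then show ?thesis by (intro two_B_cover[OF B a, of _ "T 0" "{}"]) (use low in auto)
  qed
  then show ?thesis by (rule clique_cover_mono) auto
qed

text \<open>Here \<open>z\<close>, \<open>r0\<close>, \<open>r1\<close>, \<open>m\<close> are the
  sizes of \<open>Z\<close>, \<open>U 0\<close>, \<open>U 1\<close>, \<open>T 0\<close>;
  \<open>e\<close> tells whether \<open>A 2 \<union> A 4\<close> costs a clique, and
  \<open>y\<close> is the size of \<open>T2\<close>. With \<open>c = 2 * a - (3 + e)\<close>, the
  last three conclusions are the requirements of \<open>two_B_cover\<close>.\<close>

lemma two_B_arith:
  fixes z r0 r1 m a0 a1 a2 a4 e a y :: nat
  assumes "z + r0 + 2 + a1 \<le> a" "z + r0 + 2 + a4 \<le> a" "z + r1 + 2 + a0 \<le> a" "z + r1 + 2 + a2 \<le> a"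
    and "a0 \<le> 1" "a1 \<le> 1" "a2 \<le> 1" "a4 \<le> 1" "e = 0 \<or> e = 1 \<and> (a2 = 1 \<or> a4 = 1)"
    and "m \<le> z" "r0 < r1 + m" "r1 < r0 + m" "z \<ge> 2 \<or> r0 \<ge> 1 \<or> r1 \<ge> 1"
    and y: "r1 \<le> r0 \<and> y = 1 \<or> r0 < r1 \<and> y + 1 = m"
  shows "4 \<le> a" "a + 3 + e \<le> 2 * a" "z + r0 + m + 2 + a1 + 3 + e \<le> 2 * a + y" "z + r1 + y + 2 + a0 + 3 + e \<le> 2 * a"
proof -
  have a: "a0 = 0 \<or> a0 = 1" "a1 = 0 \<or> a1 = 1" using assms(5,6) by linarith+
  note h = assms(1-8,10-12)
  show a4: "4 \<le> a" using h assms(13) by linarith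
  show "a + 3 + e \<le> 2 * a" using a4 assms(9) by linarith
  show "z + r0 + m + 2 + a1 + 3 + e \<le> 2 * a + y" using a y assms(9,13) by (elim disjE conjE) (use h in linarith)+
  show "z + r1 + y + 2 + a0 + 3 + e \<le> 2 * a" using a y assms(9,13) by (elim disjE conjE) (use h in linarith)+
qed

lemma two_B_cover_balanced:
  assumes B: "B 2 = {}" "B 3 = {}" "B 4 = {}" and a: "stability_le E V a"
    and bal: "card (U 0) < card (U 1) + card (T 0)" "card (U 1) < card (U 0) + card (T 0)"
    and edge: "b0 \<in> B 0" "b1 \<in> B 1" "E b0 b1"
  shows "clique_cover E V (2 * a - 2)"
proof -
  \<comment> \<open>The linking edge is used here: with a single \<open>z\<close> and both
    \<open>U\<close> empty, \<open>b0\<close> and \<open>b1\<close> would both be neighbours of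
    \<open>z\<close>, a triangle. Excluding this secures \<open>a \<ge> 4\<close>.\<close>
  have "\<not> (card Z = 1 \<and> U 0 = {} \<and> U 1 = {})"
  proof
    assume h: "card Z = 1 \<and> U 0 = {} \<and> U 1 = {}"
    then have "card Z = 1" by blast
    then obtain z where z: "Z = {z}" by (rule card_1_singletonE)
    have "b0 \<notin> U 0" "b1 \<notin> U 1" using h by simp_all
    then have "\<exists>w\<in>Z. E b0 w" "\<exists>w\<in>Z. E b1 w" using edge(1,2) unfolding U_def by blast+
    then have "E b0 z" "E b1 z" unfolding z by simp_all
    then show False using edge(3) common_nbr by blast
  qed
  moreover have "card Z = 1 \<or> card Z \<ge> 2" using bal card_T[of 0] by linarith
  moreover have "card (U i) = 0 \<longleftrightarrow> U i = {}" for i by (simp add: card_eq_0_iff)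
  ultimately have nontriv: "card Z \<ge> 2 \<or> card (U 0) \<ge> 1 \<or> card (U 1) \<ge> 1"
    by (metis less_one linorder_not_le)
  define e :: nat where "e = (if A 2 \<union> A 4 = {} then 0 else 1)"
  \<comment> \<open>All but one vertex of \<open>T 0\<close> go to the side with the larger
    \<open>U\<close>, and the last one goes to the other side.\<close>
  define y where "y = (if card (U 1) \<le> card (U 0) then 1 else card (T 0) - 1)"
  have m1: "card (T 0) \<ge> 1" using bal by linarith
  have "y \<le> card (T 0)" unfolding y_def using m1 by simp
  then obtain T2 where T2: "T2 \<subseteq> T 0" "card T2 = y" by (rule obtain_subset_with_card_n)
  then have T1: "card (T 0 - T2) + y = card (T 0)"
    using card_Diff_subset[of T2 "T 0"] card_mono[of "T 0" T2] finite_subset[of T2 "T 0"] by simp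
  have A1: "A k = {} \<or> card (A k) = 1" for k using card_A[of k] by (auto simp: card_eq_0_iff le_Suc_eq)
  have e: "e = 0 \<or> e = 1 \<and> (card (A 2) = 1 \<or> card (A 4) = 1)"
    unfolding e_def using A1[of 2] A1[of 4] by auto
  have y: "card (U 1) \<le> card (U 0) \<and> y = 1 \<or> card (U 0) < card (U 1) \<and> y + 1 = card (T 0)"
    unfolding y_def using m1 by auto
  note ar = two_B_arith[OF two_B_lower[OF a] two_B_lower'[OF a] card_A card_A card_A card_A e card_T bal nontriv y]
  define c where "c = 2 * a - (3 + e)"
  have c: "c + 3 + e = 2 * a" unfolding c_def using ar(2) by simp
  have "clique_cover E V (c + 1 + (if A 2 \<union> A 4 = {} then 0 else 1))"
  proof (rule two_B_cover[OF B a])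
    show "T 0 = (T 0 - T2) \<union> T2" using T2(1) by blast
    show "a \<le> c" using ar(2) c by linarith
    show "card Z + card (U 0) + card (T 0 - T2) + 2 + card (A 1) \<le> c" using ar(3) c T1 by linarith
    show "card Z + card (U 1) + card T2 + 2 + card (A 0) \<le> c" using ar(4) c T2 by linarith
  qed
  then have "clique_cover E V (c + 1 + e)" unfolding e_def .
  moreover have "c + 1 + e = 2 * a - 2" using c by linarith
  ultimately show ?thesis by simp
qed

end

section \<open>Upper bounds by type\<close>

text \<open>Without an induced 5-cycle the graph is bipartite, by distance layers from a vertex of degree
  at least two, or because it is a matching.\<close>

lemma (in p2p3_graph) cover_no_C5:
  assumes no: "\<nexists>v :: 5 \<Rightarrow> 'a. cycle_graph V E v" and a: "stability_le E V a"
  shows "clique_cover E V a"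
proof -
  have "\<exists>L R. V \<subseteq> L \<union> R \<and> stable E L \<and> stable E R"
  proof (cases "\<exists>x p q. p \<noteq> q \<and> E x p \<and> E x q")
    case True
    then obtain x p q where xpq: "p \<noteq> q" "E x p" "E x q" by blast
    \<comment> \<open>The vertices at distance two from \<open>x\<close>; an edge inside this layer
      would close an induced 5-cycle through \<open>x\<close>.\<close>
    define N2 where "N2 = {u. \<not> E x u \<and> (\<exists>w. E x w \<and> E w u)}"
    let ?R = "{u. E x u} \<union> {u. u \<noteq> x \<and> \<not> E x u \<and> u \<notin> N2}"
    have "\<not> E u w" if uw: "u \<in> N2" "w \<in> N2" for u w
    proof
      assume e: "E u w"
      from uw obtain c d where cd: "E x c" "E c u" "\<not> E x u" "E x d" "E d w" "\<not> E x w"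
        unfolding N2_def by blast
      have n: "\<not> E c d" "\<not> E c w" "\<not> E u d" "\<not> E d c" "\<not> E w c" "\<not> E d u" "\<not> E u x" "\<not> E w x"
        using cd e tri adj_sym by meson+
      have s: "E c x" "E u c" "E w u" "E w d" "E d x" using cd e adj_sym by blast+
      define f :: "5 \<Rightarrow> 'a" where
        "f i = (if i = 0 then x else if i = 1 then c else if i = 2 then u else if i = 3 then w else d)" for i
      have f: "f 0 = x" "f 1 = c" "f 2 = u" "f 3 = w" "f 4 = d" unfolding f_def by simp_all
      have "E (f i) (f j) \<longleftrightarrow> j = i + 1 \<or> i = j + 1" for i j
        using cases_5[of i] cases_5[of j] n s cd e irr by (elim disjE) (simp_all add: f)
      moreover have "inj f"
      proof (rule injI)
        fix i j assume "f i = f j"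
        then have "E (f i) (f k) \<longleftrightarrow> E (f j) (f k)" for k by simp
        then have "k = i + 1 \<or> i = k + 1 \<longleftrightarrow> k = j + 1 \<or> j = k + 1" for k using calculation by blast
        from this[of "i + 1"] this[of "i + 4"] show "i = j" using rel_5[of j i] by auto
      qed
      ultimately have "cycle_graph V E f" by unfold_locales auto
      then show False using no by blast
    qed
    then have "stable E ({x} \<union> N2)"
      unfolding stable_def using irr adj_sym unfolding N2_def by blast
    moreover have "stable E ?R"
      unfolding stable_def
    proof (intro ballI notI)
      fix u w assume uw: "u \<in> ?R" "w \<in> ?R" "E u w"
      show False
      proof (cases "E x u \<or> E x w")
        case True
        then show ?thesis using uw tri adj_sym unfolding N2_def by blast
      next
        case False
        then have "\<not> E t u" "\<not> E t w" "\<not> E u t" "\<not> E w t" if "E x t" for t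
          using uw that adj_sym unfolding N2_def by blast+
        \<comment> \<open>An edge beyond the neighbours of \<open>x\<close> and \<open>N2\<close> is
          unattached to the path \<open>p\<close>, \<open>x\<close>, \<open>q\<close>.\<close>
        then show ?thesis using p2p3[of u w p x q] xpq uw(3) False adj_sym by blast
      qed
    qed
    ultimately show ?thesis by (intro exI[of _ "{x} \<union> N2"] exI[of _ ?R]) auto
  next
    case False
    \<comment> \<open>In a matching, both ends of an edge have the same closed neighbourhood;
      choosing from that set makes \<open>rep\<close> constant on edges.\<close>
    define rep where "rep x = (SOME u. u \<in> {y. y = x \<or> E x y})" for x
    have rep: "rep x = x \<or> E x (rep x)" for x
      unfolding rep_def using someI[of "\<lambda>u. u \<in> {y. y = x \<or> E x y}" x] by blast
    have "{z. z = x \<or> E x z} = {z. z = y \<or> E y z}" if "E x y" for x y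
      using that False adj_sym by blast
    then have same: "rep x = rep y" if "E x y" for x y unfolding rep_def using that by metis
    have "stable E {x. rep x = x}" unfolding stable_def
    proof (intro ballI notI)
      fix x y assume "x \<in> {x. rep x = x}" "y \<in> {x. rep x = x}" "E x y"
      then have "x = y" using same[of x y] by simp
      then show False using \<open>E x y\<close> irr by simp
    qed
    moreover have "stable E {x. rep x \<noteq> x}" unfolding stable_def
    proof (intro ballI notI)
      fix x y assume xy: "x \<in> {x. rep x \<noteq> x}" "y \<in> {x. rep x \<noteq> x}" "E x y"
      then have "E x (rep x)" using rep[of x] by simp
      then have "rep x = y" using False xy(3) by blast
      then show False using same[OF xy(3)] xy(2) by simp
    qed
    ultimately show ?thesis by (intro exI[of _ "{x. rep x = x}"] exI[of _ "{x. rep x \<noteq> x}"]) auto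
  qed
  then obtain L R where "V \<subseteq> L \<union> R" "stable E L" "stable E R" by blast
  then show ?thesis using split_cover[of V "{}" L R 0 a] a by (simp add: clique_cover_empty)
qed

section \<open>Sorting the graphs with a 5-cycle into the three cases\<close>

context cycle_graph
begin

lemma U_rotate: "cycle_graph.U V E (\<lambda>j. v (j + k)) i = U (i + k)"
proof -
  interpret r: cycle_graph V E "\<lambda>j. v (j + k)" by (rule rotate)
  show ?thesis unfolding U_def r.U_def rotate_sets by simp
qed

lemma T_rotate: "cycle_graph.T V E (\<lambda>j. v (j + k)) i = T (i + k)"
proof -
  interpret r: cycle_graph V E "\<lambda>j. v (j + k)" by (rule rotate)
  show ?thesis unfolding T_def r.T_def rotate_sets by (simp add: algebra_simps)
qed

text \<open>The condition on the absolute value in B_1, split to avoid subtraction, with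
  \<open>T i\<close> in the place of M.\<close>

definition balanced :: "5 \<Rightarrow> bool" where
  "balanced i \<longleftrightarrow> card (U i) < card (U (i + 1)) + card (T i) \<and> card (U (i + 1)) < card (U i) + card (T i)"

lemma balanced_rotate: "cycle_graph.balanced V E (\<lambda>j. v (j + k)) i \<longleftrightarrow> balanced (i + k)"
proof -
  interpret r: cycle_graph V E "\<lambda>j. v (j + k)" by (rule rotate)
  show ?thesis unfolding balanced_def r.balanced_def U_rotate T_rotate by (simp add: algebra_simps)
qed

definition type1 :: bool where
  "type1 \<longleftrightarrow> (\<exists>i. (\<forall>j. B j \<noteq> {} \<longleftrightarrow> j = i \<or> j = i + 1) \<and>
     (\<exists>x\<in>B i. \<exists>y\<in>B (i + 1). E x y) \<and> balanced i)"

definition type2 :: bool where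
  "type2 \<longleftrightarrow> (\<forall>z\<in>Z. \<forall>x. \<not> E z x) \<and> (\<forall>j. A j = {}) \<and> (\<forall>j. \<exists>x\<in>B j. \<exists>y\<in>B (j + 1). E x y)"

lemma cover_type2: "type2 \<Longrightarrow> stability_le E V a \<Longrightarrow> \<exists>k. clique_cover E V k \<and> 2 * k + 2 \<le> 3 * a"
  using cover_all_B_edges unfolding type2_def by blast

lemma cover_type1:
  assumes "type1" and a: "stability_le E V a"
  shows "clique_cover E V (2 * a - 2)"
proof -
  from assms obtain i b0 b1 where i: "\<And>j. B j \<noteq> {} \<longleftrightarrow> j = i \<or> j = i + 1" "balanced i"
    and b: "b0 \<in> B i" "b1 \<in> B (i + 1)" "E b0 b1"
    unfolding type1_def by blast
  interpret r: cycle_graph V E "\<lambda>j. v (j + i)" by (rule rotate)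
  have "r.balanced 0" using i(2) by (simp add: balanced_rotate)
  moreover have "B (2 + i) = {}" "B (3 + i) = {}" "B (4 + i) = {}"
    using i(1)[of "2 + i"] i(1)[of "3 + i"] i(1)[of "4 + i"] by auto
  ultimately show ?thesis
    using b by (intro r.two_B_cover_balanced[OF _ _ _ a, of b0 b1])
      (auto simp: rotate_sets r.balanced_def add.commute)
qed

lemma cover_S2_edge_0:
  assumes b: "b0 \<in> B 0" "b1 \<in> B 1" "E b0 b1" and z: "z \<in> Z" "E z x" and a: "stability_le E V a"
    and n: "\<not> (B 2 = {} \<and> B 3 = {} \<and> B 4 = {} \<and> balanced 0)"
  shows "clique_cover E V (a + 3)"
proof -
  have gaps: "B 3 = {}" "B 2 = {} \<or> B 4 = {}" using S2_gaps[OF b z] by blast+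
  consider "B 2 = {}" "B 4 = {}" | "B 2 = {}" "B 4 \<noteq> {}" | "B 4 = {}" "B 2 \<noteq> {}" using gaps(2) by blast
  then show ?thesis
  proof cases
    case 1
    then have "\<not> balanced 0" using n gaps by blast
    then show ?thesis using 1 gaps(1) a unfolding balanced_def
      by (intro two_B_cover_unbalanced) (auto simp: not_less)
  next
    case 2
    then show ?thesis using cover_S2_gap[OF b] gaps a by blast
  next
    case 3
    \<comment> \<open>The reflection swaps \<open>B 0\<close> with \<open>B 1\<close> and
      \<open>B 2\<close> with \<open>B 4\<close>, which turns this case into the previous
      one.\<close>
    interpret r: cycle_graph V E "\<lambda>j. v (1 - j)" by (rule reflect)
    show ?thesis
      by (rule r.cover_S2_gap[of b1 b0])
        (use b 3 gaps a adj_sym in \<open>simp_all add: reflect_sets neg_5\<close>)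
  qed
qed

text \<open>If \<open>Z\<close> is isolated and all consecutive sets \<open>B j\<close> are linked,
  each \<open>A j\<close> is empty, since it would be complete to two linked sets; so this is
  \<open>type2\<close>. A link together with a nonisolated vertex of \<open>Z\<close> leads to
  \<open>S2_gaps\<close>.\<close>

lemma cover_other:
  assumes "\<not> type1" "\<not> type2" and a: "stability_le E V a"
  shows "clique_cover E V (a + 3)"
proof (cases "\<forall>z\<in>Z. \<forall>x. \<not> E z x")
  case True
  then have Z: "\<And>z x. z \<in> Z \<Longrightarrow> \<not> E z x" by blast
  show ?thesis
  proof (cases "\<forall>j. \<exists>x\<in>B j. \<exists>y\<in>B (j + 1). E x y")
    case True
    have "A j = {}" for j
    proof (rule equals0I)
      fix x assume x: "x \<in> A j"
      obtain p q where "p \<in> B (j + 2)" "q \<in> B (j + 2 + 1)" "E p q" using True by blast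
      then show False using A_P2[OF x, of p] A_P3[OF x, of q] tri[of x p q] by (simp add: add.commute)
    qed
    then show ?thesis using True Z assms(2) unfolding type2_def by blast
  next
    case False
    then obtain k where "\<not> (\<exists>x\<in>B k. \<exists>y\<in>B (k + 1). E x y)" by blast
    then show ?thesis using cover_no_S2[OF Z _ a, of k] by blast
  qed
next
  case False
  then obtain z x where z: "z \<in> Z" "E z x" by blast
  show ?thesis
  proof (cases "\<exists>i. \<exists>x\<in>B i. \<exists>y\<in>B (i + 1). E x y")
    case False
    then show ?thesis using cover_B_stable[OF _ a] by blast
  next
    case True
    then obtain i b0 b1 where b: "b0 \<in> B i" "b1 \<in> B (i + 1)" "E b0 b1" by blast
    interpret r: cycle_graph V E "\<lambda>j. v (j + i)" by (rule rotate)
    have "\<not> (B (2 + i) = {} \<and> B (3 + i) = {} \<and> B (4 + i) = {} \<and> balanced i)"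
    proof
      assume h: "B (2 + i) = {} \<and> B (3 + i) = {} \<and> B (4 + i) = {} \<and> balanced i"
      have "B j \<noteq> {} \<longleftrightarrow> j = i \<or> j = i + 1" for j
        using rel_5[of j i] h b by (auto simp: add.commute)
      then show False using assms(1) b h unfolding type1_def by blast
    qed
    then show ?thesis using b z a
      by (intro r.cover_S2_edge_0[of b0 b1 z x]) (simp_all add: rotate_sets balanced_rotate add.commute)
  qed
qed

text \<open>The bijection sends \<open>z\<close> to its neighbours in \<open>B i\<close> and
  \<open>B (i + 1)\<close>: \<open>P_unique\<close> leaves one in each, \<open>Z_unique\<close>
  gives injectivity, and \<open>Z_nonadj\<close> surjectivity.\<close>

lemma card_nonadjacent_pairs:
  "card {{x, y} | x y. x \<in> B i - U i \<and> y \<in> B (i + 1) - U (i + 1) \<and> \<not> E x y} = card (T i)"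
    (is "card ?M = _")
proof -
  let ?f = "\<lambda>z. {x \<in> B i \<union> B (i + 1). E z x}"
  have f: "?f z = {x, y}" if "z \<in> Z" "x \<in> B i" "y \<in> B (i + 1)" "E z x" "E z y" for x y z
    using that P_unique[of _ i x z] P_unique[of _ "i + 1" y z] B_P by auto
  have "bij_betw ?f (T i) ?M" unfolding bij_betw_def
  proof
    show "inj_on ?f (T i)"
    proof (rule inj_onI)
      fix z w assume zw: "z \<in> T i" "w \<in> T i" "?f z = ?f w"
      then obtain x where x: "x \<in> B i" "E z x" unfolding T_def by blast
      then have "E w x" using zw(3) by blast
      then show "z = w" using Z_unique[OF B_P[OF x(1)], of z w] zw x adj_sym unfolding T_def by blast
    qed
    show "?f ` T i = ?M"
    proof (intro equalityI subsetI)
      fix S assume "S \<in> ?f ` T i"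
      then obtain z x y where z: "S = ?f z" "z \<in> Z" "x \<in> B i" "y \<in> B (i + 1)" "E z x" "E z y"
        unfolding T_def by blast
      then have "S = {x, y}" using f by simp
      moreover have "x \<notin> U i" "y \<notin> U (i + 1)" "\<not> E x y" unfolding U_def using z adj_sym tri by blast+
      ultimately show "S \<in> ?M" using z by blast
    next
      fix S assume "S \<in> ?M"
      then obtain x y where xy: "S = {x, y}" "x \<in> B i" "x \<notin> U i" "y \<in> B (i + 1)" "\<not> E x y" by blast
      then obtain z where z: "z \<in> Z" "E x z" unfolding U_def by blast
      then have "E z x" "E z y"
        using Z_nonadj[OF B_P[OF xy(2)] B_P[OF xy(4)] xy(5) z(1)] adj_sym by blast+
      then show "S \<in> ?f ` T i" using f[OF z(1) xy(2,4)] z(1) xy unfolding T_def by (intro image_eqI[of _ _ z]) blast+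
    qed
  qed
  then show ?thesis using bij_betw_same_card by fastforce
qed

end

section \<open>From a graph to its complement\<close>

lemma verts_complement [simp]: "verts (complement G) = verts G"
  unfolding complement_def by simp

lemma adj_complement: "adj (complement G) x y \<longleftrightarrow> x \<in> verts G \<and> y \<in> verts G \<and> x \<noteq> y \<and> \<not> adj G x y"
  unfolding adj_def complement_def by (auto simp: doubleton_eq_iff insert_commute)

lemma adj_commute: "adj G x y \<longleftrightarrow> adj G y x"
  unfolding adj_def by (simp add: insert_commute)

lemma verts_induced [simp]: "verts (induced G W) = W"
  unfolding induced_def by simp

lemma adj_induced: "adj (induced G W) x y \<longleftrightarrow> x \<in> W \<and> y \<in> W \<and> adj G x y"
  unfolding adj_def induced_def by auto

lemma simple_graph_irrefl: "simple_graph G \<Longrightarrow> \<not> adj G x x"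
  unfolding simple_graph_def adj_def by fastforce

definition induced_copy :: "('b \<Rightarrow> 'a) \<Rightarrow> 'b graph \<Rightarrow> 'a graph \<Rightarrow> bool" where
  "induced_copy g F G \<longleftrightarrow> inj_on g (verts F) \<and> g ` verts F \<subseteq> verts G \<and>
     (\<forall>i\<in>verts F. \<forall>j\<in>verts F. adj F i j \<longleftrightarrow> adj G (g i) (g j))"

lemma induced_copy_iff:
  "(\<exists>W\<subseteq>verts G. isomorphic (induced G W) F) \<longleftrightarrow>
   (\<exists>g. induced_copy g F G)"
proof
  assume "\<exists>W\<subseteq>verts G. isomorphic (induced G W) F"
  then obtain W f where W: "W \<subseteq> verts G" and f: "bij_betw f W (verts F)"
    and e: "\<forall>x\<in>W. \<forall>y\<in>W. adj (induced G W) x y \<longleftrightarrow> adj F (f x) (f y)"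
    unfolding isomorphic_def by auto
  let ?g = "inv_into W f"
  have g: "bij_betw ?g (verts F) W" using f by (rule bij_betw_inv_into)
  have "adj F i j \<longleftrightarrow> adj G (?g i) (?g j)" if "i \<in> verts F" "j \<in> verts F" for i j
    using e bij_betw_apply[OF g] that f by (auto simp: adj_induced bij_betw_inv_into_right[OF f])
  then show "\<exists>g. induced_copy g F G"
    using g W unfolding bij_betw_def induced_copy_def by (intro exI[of _ ?g]) auto
next
  assume "\<exists>g. induced_copy g F G"
  then obtain g where g: "inj_on g (verts F)" "g ` verts F \<subseteq> verts G"
    "\<forall>i\<in>verts F. \<forall>j\<in>verts F. adj F i j \<longleftrightarrow> adj G (g i) (g j)"
    unfolding induced_copy_def by blast
  let ?f = "inv_into (verts F) g"
  have "bij_betw ?f (g ` verts F) (verts F)"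
    using g(1) by (simp add: inj_on_imp_bij_betw bij_betw_inv_into)
  moreover have "adj (induced G (g ` verts F)) x y \<longleftrightarrow> adj F (?f x) (?f y)"
    if "x \<in> g ` verts F" "y \<in> g ` verts F" for x y
    using that g by (auto simp: adj_induced)
  ultimately have "isomorphic (induced G (g ` verts F)) F"
    unfolding isomorphic_def by auto
  then show "\<exists>W\<subseteq>verts G. isomorphic (induced G W) F" using g(2) by blast
qed

lemma adj_three_K1: "\<not> adj three_K1 i j"
  unfolding adj_def three_K1_def by simp

lemma adj_paraglider:
  "adj paraglider i j \<longleftrightarrow> (i, j) \<in> {(0,1),(1,0),(1,2),(2,1),(2,3),(3,2),(3,0),(0,3),(4,0),(0,4),(4,1),(1,4),(4,2),(2,4)}"
  unfolding adj_def paraglider_def by (auto simp: doubleton_eq_iff)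

lemma verts_three_K1: "verts three_K1 = {0, 1, 2}"
  and verts_paraglider: "verts paraglider = {0, 1, 2, 3, 4}"
  unfolding three_K1_def paraglider_def by simp_all

text \<open>The complement of 3K_1 is a triangle, and that of the paraglider consists of the edge 0,
  2 and the path 1, 3, 4.\<close>

lemma free_iff_p2p3_graph:
  assumes "simple_graph G"
  shows "free_of {three_K1, paraglider} G \<longleftrightarrow> p2p3_graph (verts G) (adj (complement G))"
proof
  let ?E = "adj (complement G)"
  note E = adj_complement
  assume "free_of {three_K1, paraglider} G"
  then have n3: "\<not> (induced_copy g three_K1 G)"
    and np: "\<not> (induced_copy g paraglider G)" for g
    unfolding free_of_def induced_copy_iff by blast+
  have tri: "\<not> ?E x z" if "?E x y" "?E y z" for x y z
  proof
    assume "?E x z"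
    with that n3[of "\<lambda>i. if i = 0 then x else if i = 1 then y else z"] show False
      using simple_graph_irrefl[OF assms]
      by (auto simp: induced_copy_def E adj_three_K1 verts_three_K1 inj_on_def adj_commute[of G])
  qed
  show "p2p3_graph (verts G) ?E"
  proof
    show "finite (verts G)" using assms unfolding simple_graph_def by blast
    show "?E x y \<Longrightarrow> x \<in> verts G" "?E x y \<Longrightarrow> ?E y x" for x y by (auto simp: E adj_commute[of G])
    show "?E x y \<Longrightarrow> ?E y z \<Longrightarrow> \<not> ?E x z" for x y z by (rule tri)
    fix a b p q r assume h: "?E a b" "?E p q" "?E q r" "p \<noteq> r"
    show "?E a p \<or> ?E a q \<or> ?E a r \<or> ?E b p \<or> ?E b q \<or> ?E b r"
    proof (rule ccontr)
      assume n: "\<not> ?thesis"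
      let ?g = "\<lambda>i :: nat. if i = 0 then a else if i = 1 then p else if i = 2 then b else if i = 3 then q else r"
      have sym: "?E x y \<longleftrightarrow> ?E y x" for x y by (auto simp: E adj_commute[of G])
      have d: "a \<noteq> b" "a \<noteq> p" "a \<noteq> q" "a \<noteq> r" "b \<noteq> p" "b \<noteq> q" "b \<noteq> r" "p \<noteq> q" "q \<noteq> r"
        using h n sym unfolding E by metis+
      have V: "a \<in> verts G" "b \<in> verts G" "p \<in> verts G" "q \<in> verts G" "r \<in> verts G"
        using h unfolding E by auto
      have na: "\<not> adj G a b" "\<not> adj G p q" "\<not> adj G q r" using h unfolding E by auto
      have ya: "adj G a p" "adj G a q" "adj G a r" "adj G b p" "adj G b q" "adj G b r" "adj G p r"
        using n d V tri[OF h(2,3)] h(4) unfolding E by auto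
      have na': "\<not> adj G b a" "\<not> adj G q p" "\<not> adj G r q" using na adj_commute by metis+
      have ya': "adj G p a" "adj G q a" "adj G r a" "adj G p b" "adj G q b" "adj G r b" "adj G r p"
        using ya adj_commute by metis+
      have "inj_on ?g (verts paraglider)" unfolding verts_paraglider inj_on_def using d h(4) by auto
      moreover have "?g ` verts paraglider \<subseteq> verts G" unfolding verts_paraglider using V by auto
      moreover have "\<forall>i\<in>verts paraglider. \<forall>j\<in>verts paraglider. adj paraglider i j \<longleftrightarrow> adj G (?g i) (?g j)"
        unfolding verts_paraglider adj_paraglider using na na' ya ya' simple_graph_irrefl[OF assms]
        by simp
      ultimately show False using np unfolding induced_copy_def by blast
    qed
  qed
next
  assume "p2p3_graph (verts G) (adj (complement G))"
  then interpret p2p3_graph "verts G" "adj (complement G)" .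
  note E = adj_complement
  have "\<nexists>g. induced_copy g three_K1 G"
  proof
    assume "\<exists>g. induced_copy g three_K1 G"
    then obtain g where "induced_copy g three_K1 G" by blast
    then show False
      using tri[of "g 0" "g 1" "g 2"] by (auto simp: induced_copy_def E verts_three_K1 adj_three_K1 inj_on_def)
  qed
  moreover have "\<nexists>g. induced_copy g paraglider G"
  proof
    assume "\<exists>g. induced_copy g paraglider G"
    then obtain g where copy: "induced_copy g paraglider G" by blast
    have g: "inj_on g (verts paraglider)" "g ` verts paraglider \<subseteq> verts G"
      using copy unfolding induced_copy_def by blast+
    have e: "adj G (g i) (g j) \<longleftrightarrow> adj paraglider i j" if "i \<in> verts paraglider" "j \<in> verts paraglider" for i j
      using copy that unfolding induced_copy_def by blast
    have c: "adj (complement G) (g i) (g j) \<longleftrightarrow> i \<noteq> j \<and> \<not> adj paraglider i j"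
      if "i \<in> verts paraglider" "j \<in> verts paraglider" for i j
      using that g e by (auto simp: E inj_on_eq_iff)
    have "g 1 \<noteq> g 4" using g(1) by (auto simp: verts_paraglider inj_on_def)
    moreover have "adj (complement G) (g 0) (g 2)" "adj (complement G) (g 1) (g 3)"
      "adj (complement G) (g 3) (g 4)" "\<not> adj (complement G) (g 0) (g 1)"
      "\<not> adj (complement G) (g 0) (g 3)" "\<not> adj (complement G) (g 0) (g 4)"
      "\<not> adj (complement G) (g 2) (g 1)" "\<not> adj (complement G) (g 2) (g 3)"
      "\<not> adj (complement G) (g 2) (g 4)"
      by (subst c; simp add: verts_paraglider adj_paraglider)+
    ultimately show False
      using p2p3 by blast
  qed
  ultimately show "free_of {three_K1, paraglider} G"
    unfolding free_of_def induced_copy_iff by blast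
qed

lemma colorable_iff_clique_cover:
  assumes "simple_graph G"
  shows "colorable G k \<longleftrightarrow> clique_cover (adj (complement G)) (verts G) k"
proof -
  have "(adj G x y \<longrightarrow> c x \<noteq> c y) \<longleftrightarrow> (c x = c y \<longrightarrow> x = y \<or> adj (complement G) x y)"
    if "x \<in> verts G" "y \<in> verts G" for x y and c :: "'a \<Rightarrow> nat"
    using that simple_graph_irrefl[OF assms] by (auto simp: adj_complement)
  then show ?thesis unfolding colorable_def clique_cover_def by (intro ex_cong1 conj_cong ball_cong refl)
qed

lemma chromatic_number_le: "colorable G k \<Longrightarrow> \<chi> G \<le> k"
  unfolding chromatic_number_def by (rule Least_le)

lemma colorable_chromatic_number: "simple_graph G \<Longrightarrow> colorable G (\<chi> G)"
  unfolding chromatic_number_def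
  by (rule LeastI[of _ "card (verts G)"])
    (simp add: colorable_iff_clique_cover clique_cover_card simple_graph_def)

lemma is_clique_iff_stable:
  "is_clique G K \<longleftrightarrow> K \<subseteq> verts G \<and> stable (adj (complement G)) K"
  unfolding is_clique_def stable_def by (auto simp: adj_complement)

lemma clique_sizes_finite:
  assumes "simple_graph G"
  shows "finite {card K | K. is_clique G K}" "{card K | K. is_clique G K} \<noteq> {}"
proof -
  have "{card K | K. is_clique G K} \<subseteq> card ` Pow (verts G)" unfolding is_clique_def by auto
  then show "finite {card K | K. is_clique G K}"
    using assms unfolding simple_graph_def by (meson finite_Pow_iff finite_imageI finite_subset)
  have "is_clique G {}" unfolding is_clique_def by simp
  then show "{card K | K. is_clique G K} \<noteq> {}" by blast
qed

lemma stability_le_clique_number: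
  assumes "simple_graph G"
  shows "stability_le (adj (complement G)) (verts G) (\<omega> G)"
  unfolding stability_le_def clique_number_def
  by (intro allI impI Max_ge clique_sizes_finite[OF assms]) (auto simp: is_clique_iff_stable)

lemma clique_number_le:
  assumes "simple_graph G" "stability_le (adj (complement G)) (verts G) a"
  shows "\<omega> G \<le> a"
  unfolding clique_number_def
  using clique_sizes_finite[OF assms(1)] assms(2)
  by (auto simp: is_clique_iff_stable stability_le_def)

section \<open>Distance layers and the component H\<close>

lemma dist_to_eq_iff:
  "dist_to G x S = enat k \<longleftrightarrow>
     (\<exists>s\<in>S. (adj G ^^ k) x s) \<and> (\<forall>n<k. \<not> (\<exists>s\<in>S. (adj G ^^ n) x s))"
proof -
  define N where "N = {n. \<exists>s\<in>S. (adj G ^^ n) x s}"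
  have d: "dist_to G x S = Inf (enat ` N)" unfolding dist_to_def N_def ..
  have "Inf (enat ` N) = enat k \<longleftrightarrow> k \<in> N \<and> (\<forall>n<k. n \<notin> N)"
  proof
    assume h: "Inf (enat ` N) = enat k"
    then have ne: "enat ` N \<noteq> {}" by (auto simp: top_enat_def)
    then have "Inf (enat ` N) \<in> enat ` N" unfolding Inf_enat_def by (auto intro: LeastI)
    then have "k \<in> N" using h by auto
    moreover have "k \<le> n" if "n \<in> N" for n
      using Inf_lower[of "enat n" "enat ` N"] h that by simp
    ultimately show "k \<in> N \<and> (\<forall>n<k. n \<notin> N)" by (meson not_le)
  next
    assume h: "k \<in> N \<and> (\<forall>n<k. n \<notin> N)"
    show "Inf (enat ` N) = enat k"
    proof (rule antisym)
      show "Inf (enat ` N) \<le> enat k" using h by (intro Inf_lower) blast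
      show "enat k \<le> Inf (enat ` N)" using h by (intro Inf_greatest) (auto simp: not_less[symmetric])
    qed
  qed
  then show ?thesis unfolding d unfolding N_def by simp
qed

text \<open>H contains the cycle and is closed under adjacency, so it contains every vertex with a
  walk to the cycle; the sets defined by distances in H can then be read off in
  \<open>V\<close>.\<close>

locale component_graph = cycle_graph +
  fixes H :: "'a graph"
  assumes v_H: "range v \<subseteq> verts H"
    and H_V: "verts H \<subseteq> V"
    and H_closed: "x \<in> verts H \<Longrightarrow> E x y \<Longrightarrow> y \<in> verts H"
    and H_adj: "adj H x y \<longleftrightarrow> x \<in> verts H \<and> E x y"
begin

lemma v_in_H: "v i \<in> verts H"
  using v_H by blast

lemma nbrs_H: "x \<in> verts H \<Longrightarrow> nbrs H x = {y. E x y}"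
  unfolding nbrs_def using H_adj H_closed by auto

lemma layer1: "layer H v 1 = {x. x \<notin> range v \<and> (\<exists>j. E x (v j))}"
proof -
  have "x \<in> verts H" if "E x (v j)" for x j using H_closed[OF v_in_H] that adj_sym by blast
  then show ?thesis
    unfolding layer_def dist_to_eq_iff using H_adj by (auto simp: less_Suc_eq eq_OO)
qed

text \<open>A vertex of \<open>Z\<close> with a neighbour sees some \<open>B i\<close> by
  \<open>Z_nbr\<close>, which puts it into H at distance exactly two; the rest of \<open>Z\<close>
  is isolated.\<close>

lemma layer2: "layer H v 2 = {z \<in> Z. \<exists>x. E z x}"
proof -
  have rel: "(adj H ^^ 2) x y \<longleftrightarrow> (\<exists>w. adj H x w \<and> adj H w y)" for x y
    by (auto simp: numeral_2_eq_2 relcompp_apply)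
  have iff: "x \<in> layer H v 2 \<longleftrightarrow> x \<in> verts H - range v \<and> (\<exists>w j. E x w \<and> E w (v j)) \<and> (\<forall>j. \<not> E x (v j))" for x
    unfolding layer_def dist_to_eq_iff
    using H_closed by (auto simp: less_2_cases_iff rel H_adj eq_OO)
  show ?thesis
  proof (intro equalityI subsetI)
    fix z assume "z \<in> layer H v 2"
    then show "z \<in> {z \<in> Z. \<exists>x. E z x}" using H_V unfolding iff Z_def by auto
  next
    fix z assume "z \<in> {z \<in> Z. \<exists>x. E z x}"
    then obtain x where zx: "z \<in> Z" "E z x" by blast
    obtain i where "x \<in> B i" using Z_nbr[OF zx] by blast
    then have x: "E x (v (i + 1))" using P_v[OF B_P] by simp
    then have "z \<in> verts H" using zx adj_sym H_closed v_in_H by blast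
    moreover have "z \<notin> range v" using zx v_notin_Z by blast
    moreover have "\<forall>j. \<not> E z (v j)" using Z_v[OF zx(1)] by blast
    ultimately show "z \<in> layer H v 2" unfolding iff using zx(2) x by blast
  qed
qed

lemma nbrs_on_cycle:
  assumes "x \<in> verts H"
  shows "nbrs H x \<inter> range v = v ` J \<longleftrightarrow> (\<forall>j. E x (v j) \<longleftrightarrow> j \<in> J)"
proof -
  have "nbrs H x \<inter> range v = v ` {j. E x (v j)}" using nbrs_H[OF assms] by blast
  then show ?thesis using inj_image_eq_iff[OF inj_v, of "{j. E x (v j)}" J] by blast
qed

lemma A_set_eq: "A_set H v i = A i"
proof -
  have "x \<in> A_set H v i \<longleftrightarrow> x \<in> A i" for x
  proof (cases "x \<in> verts H")
    case True
    have "nbrs H x \<inter> range v = {v i} \<longleftrightarrow> (\<forall>j. E x (v j) \<longleftrightarrow> j = i)"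
      using nbrs_on_cycle[OF True, of "{i}"] by simp
    then show ?thesis unfolding A_set_def layer1 using v_notin_A[of _ i] H_V True
      by (auto simp: A_def)
  next
    case False
    then have "x \<notin> A i" using A_v[of x i i] adj_sym H_closed v_in_H by blast
    then show ?thesis using False unfolding A_set_def layer_def by simp
  qed
  then show ?thesis by blast
qed

lemma B_set_eq: "B_set H v i = B i"
proof -
  have eq: "i - 1 = i + 4" by simp
  have "x \<in> B_set H v i \<longleftrightarrow> x \<in> B i" for x
  proof (cases "x \<in> verts H")
    case True
    have "nbrs H x \<inter> range v = {v (i - 1), v (i + 1)} \<longleftrightarrow> (\<forall>j. E x (v j) \<longleftrightarrow> j = i + 1 \<or> j = i + 4)"
      using nbrs_on_cycle[OF True, of "{i + 4, i + 1}"] unfolding eq by (simp add: disj_commute)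
    then show ?thesis
      unfolding B_set_def layer1 using v_notin_B[of _ i] H_V True
      by (auto simp: B_def P_def)
  next
    case False
    then have "x \<notin> B i" using P_v[of x i "i + 1"] B_P adj_sym H_closed v_in_H by blast
    then show ?thesis using False unfolding B_set_def layer_def by simp
  qed
  then show ?thesis by blast
qed

lemma B_nbrs: "x \<in> B i \<Longrightarrow> x \<in> nbrs_of_set H (layer H v 2) \<longleftrightarrow> x \<notin> U i"
proof -
  assume x: "x \<in> B i"
  have xH: "x \<in> verts H" using x B_set_eq[of i] unfolding B_set_def layer_def by blast
  have "x \<notin> Z" using x B_P disj_other by blast
  then show ?thesis
    unfolding nbrs_of_set_def layer2 U_def using x xH H_adj H_closed adj_sym by blast
qed

lemma edges_between_B: "edges_between H (B i) (B k) \<noteq> {} \<longleftrightarrow> (\<exists>x\<in>B i. \<exists>y\<in>B k. E x y)"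
proof -
  have "x \<in> verts H" if "x \<in> B i" for x using that B_set_eq[of i] unfolding B_set_def layer_def by blast
  then show ?thesis
    unfolding edges_between_def using H_adj unfolding adj_def by blast
qed

lemma class_B2_iff: "class_B2 H v \<longleftrightarrow> type2"
proof -
  have "h_A H v = 0 \<longleftrightarrow> (\<forall>j. A j = {})" unfolding h_A_def A_set_eq by (auto simp: card_eq_0_iff)
  moreover have "h_B H v = 5" if "\<forall>j. B j \<noteq> {}" using that unfolding h_B_def B_set_eq by simp
  moreover have "layer H v 2 = {} \<longleftrightarrow> (\<forall>z\<in>Z. \<forall>x. \<not> E z x)" unfolding layer2 by blast
  ultimately show ?thesis
    unfolding class_B2_def type2_def B_set_eq edges_between_B by blast
qed

text \<open>From right to left, balance makes \<open>T i\<close> nonempty, hence S_2 and M as well;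
  a vertex of \<open>A (i - 2)\<close> would be complete to \<open>B i\<close> and
  \<open>B (i + 1)\<close> and close a triangle over their linking edge.\<close>

lemma class_B1_iff: "class_B1 H v \<longleftrightarrow> type1"
proof -
  have M: "M_set H v i = {{x, y} | x y. x \<in> B i - U i \<and> y \<in> B (i + 1) - U (i + 1) \<and> \<not> E x y}" for i
  proof -
    have "x \<in> verts H" if "x \<in> B i" for x using that B_set_eq[of i] unfolding B_set_def layer_def by blast
    then show ?thesis
      unfolding M_set_def B_set_eq using B_nbrs[of _ i] B_nbrs[of _ "i + 1"] H_adj by blast
  qed
  have cM: "card (M_set H v i) = card (T i)" for i unfolding M card_nonadjacent_pairs ..
  have diff: "B i - nbrs_of_set H (layer H v 2) = U i" for i
    using B_nbrs unfolding U_def by blast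
  have bal: "\<bar>int (card (U i)) - int (card (U (i + 1)))\<bar> < int (card (T i)) \<longleftrightarrow> balanced i" for i
    unfolding balanced_def by linarith
  show ?thesis
  proof
    assume h: "class_B1 H v"
    then obtain i where i: "B i \<noteq> {}" "B (i + 1) \<noteq> {}" "\<exists>x\<in>B i. \<exists>y\<in>B (i + 1). E x y" "balanced i"
      unfolding class_B1_def B_set_eq edges_between_B diff cM bal by blast
    have "card {j. B j \<noteq> {}} = 2" using h unfolding class_B1_def h_B_def B_set_eq by blast
    moreover have "card {i, i + 1} = 2" by simp
    moreover have "{i, i + 1} \<subseteq> {j. B j \<noteq> {}}" using i by blast
    ultimately have "{i, i + 1} = {j. B j \<noteq> {}}" by (intro card_subset_eq) auto
    then show type1 unfolding type1_def using i by (intro exI[of _ i]) blast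
  next
    assume type1
    then obtain i where i: "\<And>j. B j \<noteq> {} \<longleftrightarrow> j = i \<or> j = i + 1"
      "\<exists>x\<in>B i. \<exists>y\<in>B (i + 1). E x y" "balanced i" unfolding type1_def by blast
    have "{j. B j \<noteq> {}} = {i, i + 1}" using i(1) by blast
    then have h: "h_B H v = 2" unfolding h_B_def B_set_eq by simp
    have T: "card (T i) > 0" using i(3) unfolding balanced_def by linarith
    then have "T i \<noteq> {}" by auto
    then have S2: "layer H v 2 \<noteq> {}" unfolding layer2 T_def by blast
    have "M_set H v i \<noteq> {}" using T cM[of i] by auto
    moreover have "A (i - 2) = {}"
    proof (rule equals0I)
      fix x assume "x \<in> A (i - 2)"
      moreover have "i - 2 = i + 3" by simp
      ultimately have x: "x \<in> A (i + 3)" by metis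
      obtain p q where "p \<in> B i" "q \<in> B (i + 1)" "E p q" using i(2) by blast
      then show False using A_P2[OF x, of p] A_P3[OF x, of q] tri[of x p q] by (simp add: add.commute)
    qed
    ultimately show "class_B1 H v"
      unfolding class_B1_def B_set_eq A_set_eq edges_between_B diff cM bal using h S2 i by blast
  qed
qed

end

lemma admissible_component_graph:
  assumes "admissible G H v"
  shows "component_graph (verts G) (adj (complement G)) v H"
proof -
  let ?E = "adj (complement G)"
  from assms have G: "simple_graph G" "free_of {three_K1, paraglider} G" "induced_5_cycle H v"
    unfolding admissible_def by blast+
  obtain x where x: "x \<in> verts G" "H = induced (complement G) {y. ?E\<^sup>*\<^sup>* x y}"
    using assms unfolding admissible_def is_component_def by auto
  interpret p2p3_graph "verts G" ?E using free_iff_p2p3_graph G by blast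
  have cl: "y \<in> verts H \<Longrightarrow> ?E y z \<Longrightarrow> z \<in> verts H" for y z
    unfolding x(2) by (simp add: rtranclp.rtrancl_into_rtrancl)
  have sub: "verts H \<subseteq> verts G"
  proof
    fix y assume "y \<in> verts H"
    then have "?E\<^sup>*\<^sup>* x y" unfolding x(2) by simp
    then show "y \<in> verts G" by (induction rule: rtranclp_induct) (auto simp: x adj_complement)
  qed
  have adjH: "adj H y z \<longleftrightarrow> y \<in> verts H \<and> ?E y z" for y z
    using cl[of y z] unfolding x(2) adj_induced by auto
  show ?thesis
  proof
    show "inj v" "range v \<subseteq> verts H" using G(3) unfolding induced_5_cycle_def by blast+
    then show "?E (v i) (v j) \<longleftrightarrow> j = i + 1 \<or> i = j + 1" for i j
      using G(3) adjH unfolding induced_5_cycle_def by blast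
    show "verts H \<subseteq> verts G" by (rule sub)
    show "y \<in> verts H \<Longrightarrow> ?E y z \<Longrightarrow> z \<in> verts H" for y z by (rule cl)
    show "adj H y z \<longleftrightarrow> y \<in> verts H \<and> ?E y z" for y z by (rule adjH)
  qed
qed

lemma upper_bounds:
  assumes "admissible G H v"
  shows "class_B1 H v \<Longrightarrow> real (\<chi> G) \<le> 2 * real (\<omega> G) - 2"
    and "class_B2 H v \<Longrightarrow> real (\<chi> G) \<le> 3 * real (\<omega> G) / 2 - 1"
    and "\<not> class_B1 H v \<Longrightarrow> \<not> class_B2 H v \<Longrightarrow> real (\<chi> G) \<le> real (\<omega> G) + 3"
proof -
  interpret component_graph "verts G" "adj (complement G)" v H
    using assms by (rule admissible_component_graph)
  have G: "simple_graph G" using assms unfolding admissible_def by blast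
  note a = stability_le_clique_number[OF G]
  have le: "\<chi> G \<le> k" if "clique_cover (adj (complement G)) (verts G) k" for k
    using that chromatic_number_le colorable_iff_clique_cover[OF G] by blast
  \<comment> \<open>Makes the truncated \<open>2 * \<omega> G - 2\<close> agree with the real
    one.\<close>
  have w: "\<omega> G \<ge> 1"
  proof -
    have "stable (adj (complement G)) {v 0}" unfolding stable_def using irr by blast
    then have "card {v 0} \<le> \<omega> G" using a v_in[of 0] unfolding stability_le_def by blast
    then show ?thesis by simp
  qed
  show "real (\<chi> G) \<le> 2 * real (\<omega> G) - 2" if "class_B1 H v"
    using le[OF cover_type1[OF _ a]] that w unfolding class_B1_iff by linarith
  show "real (\<chi> G) \<le> 3 * real (\<omega> G) / 2 - 1" if B2: "class_B2 H v"
  proof -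
    obtain k where k: "clique_cover (adj (complement G)) (verts G) k" "2 * k + 2 \<le> 3 * \<omega> G"
      using cover_type2[OF iffD1[OF class_B2_iff B2] a] by blast
    then show ?thesis using le[OF k(1)] by linarith
  qed
  show "real (\<chi> G) \<le> real (\<omega> G) + 3" if "\<not> class_B1 H v" "\<not> class_B2 H v"
    using le[OF cover_other[OF _ _ a]] that unfolding class_B1_iff class_B2_iff by linarith
qed

lemma general_bound:
  assumes G: "simple_graph G" "free_of {three_K1, paraglider} G"
  shows "real (\<chi> G) \<le> max (real (\<omega> G) + 3) (2 * real (\<omega> G) - 2)"
proof -
  let ?E = "adj (complement G)"
  interpret p2p3_graph "verts G" ?E using free_iff_p2p3_graph G by blast
  note a = stability_le_clique_number[OF G(1)]
  have le: "\<chi> G \<le> k" if "clique_cover ?E (verts G) k" for k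
    using that chromatic_number_le colorable_iff_clique_cover[OF G(1)] by blast
  show ?thesis
  proof (cases "\<exists>v :: 5 \<Rightarrow> 'a. cycle_graph (verts G) ?E v")
    case False
    then have "\<chi> G \<le> \<omega> G" using le[OF cover_no_C5[OF _ a]] by blast
    then show ?thesis by linarith
  next
    case True
    then obtain v :: "5 \<Rightarrow> 'a" where "cycle_graph (verts G) ?E v" by blast
    then interpret cycle_graph "verts G" ?E v .
    consider type1 | type2 | "\<not> type1" "\<not> type2" by blast
    then show ?thesis
    proof cases
      case 1
      then have "\<chi> G \<le> 2 * \<omega> G - 2" using le[OF cover_type1[OF _ a]] by blast
      then show ?thesis by linarith
    next
      case 2
      then obtain k where k: "clique_cover ?E (verts G) k" "2 * k + 2 \<le> 3 * \<omega> G"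
        using cover_type2[OF _ a] by blast
      \<comment> \<open>The bound \<open>3 * \<omega> G / 2 - 1\<close> is at most
        \<open>\<omega> G + 3\<close> up to clique number 8 and at most
        \<open>2 * \<omega> G - 2\<close> from 2 on.\<close>
      then show ?thesis using le[OF k(1)] by linarith
    next
      case 3
      then have "\<chi> G \<le> \<omega> G + 3" using le[OF cover_other[OF _ _ a]] by blast
      then show ?thesis by linarith
    qed
  qed
qed

section \<open>Extremal graphs\<close>

text \<open>An odd cycle has no 2-colouring, while three vertices of a 5-cycle are never pairwise
  adjacent.\<close>

lemma imperfect_of_C5:
  assumes G: "simple_graph G" and w: "inj w" "range w \<subseteq> verts G"
    and adj: "\<And>i j :: 5. adj G (w i) (w j) \<longleftrightarrow> j = i + 1 \<or> i = j + 1"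
  shows "\<not> perfect G"
proof
  assume "perfect G"
  let ?F = "induced G (range w)"
  have eq: "\<chi> ?F = \<omega> ?F" using \<open>perfect G\<close> w(2) unfolding perfect_def by blast
  have F: "simple_graph ?F"
    using G unfolding simple_graph_def by (auto simp: induced_def)
  have adjF: "adj ?F (w i) (w j) \<longleftrightarrow> j = i + 1 \<or> i = j + 1" for i j
    by (simp add: adj_induced adj)
  have "\<not> colorable ?F 2"
  proof
    assume "colorable ?F 2"
    then obtain c where c: "\<And>i. c (w i) < (2::nat)" "\<And>i. c (w i) \<noteq> c (w (i + 1))"
      unfolding colorable_def using adjF by (metis rangeI verts_induced)
    have "c (w 0) \<noteq> c (w 1)" "c (w 1) \<noteq> c (w 2)" "c (w 2) \<noteq> c (w 3)" "c (w 3) \<noteq> c (w 4)" "c (w 4) \<noteq> c (w 0)"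
      using c(2)[of 0] c(2)[of 1] c(2)[of 2] c(2)[of 3] c(2)[of 4] by simp_all
    with c(1)[of 0] c(1)[of 1] c(1)[of 2] c(1)[of 3] c(1)[of 4] show False by linarith
  qed
  moreover have "stability_le (adj (complement ?F)) (verts ?F) 2"
    unfolding stability_le_def
  proof (intro allI impI)
    fix S assume S: "S \<subseteq> verts ?F" "stable (adj (complement ?F)) S"
    show "card S \<le> 2"
    proof (rule ccontr)
      assume "\<not> card S \<le> 2"
      then obtain R where R: "R \<subseteq> S" "card R = 3"
        using obtain_subset_with_card_n[of 3 S] by (metis not_less_eq_eq numeral_3_eq_3 numeral_2_eq_2)
      then obtain a b c where abc: "R = {a, b, c}" "a \<noteq> b" "b \<noteq> c" "a \<noteq> c"
        by (auto simp: card_3_iff)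
      then obtain i j k where ijk: "a = w i" "b = w j" "c = w k"
        using R S(1) by (metis insertCI rangeE subsetD verts_induced)
      have "adj ?F x y" if "x \<in> R" "y \<in> R" "x \<noteq> y" for x y
        using S that R(1) unfolding stable_def adj_complement by blast
      then have "adj ?F (w i) (w j)" "adj ?F (w j) (w k)" "adj ?F (w i) (w k)"
        using abc ijk by auto
      then show False unfolding adjF using rel_5[of j i] rel_5[of k i] by auto
    qed
  qed
  ultimately show False
    using clique_number_le[OF F] colorable_chromatic_number[OF F] eq colorable_iff_clique_cover[OF F]
      clique_cover_mono by (metis subset_refl)
qed

lemma triangle_free_chromatic_number_ge:
  assumes G: "simple_graph G" and p: "p2p3_graph (verts G) (adj (complement G))"
  shows "card (verts G) \<le> 2 * \<chi> G"
proof -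
  interpret p2p3_graph "verts G" "adj (complement G)" by (rule p)
  define Q where "Q c \<longleftrightarrow> (\<forall>x\<in>verts G. c x < \<chi> G) \<and>
    (\<forall>x\<in>verts G. \<forall>y\<in>verts G. c x = c y \<longrightarrow> x = y \<or> adj (complement G) x y)" for c :: "'a \<Rightarrow> nat"
  have "\<exists>c. Q c"
    using colorable_chromatic_number[OF G] unfolding colorable_iff_clique_cover[OF G] clique_cover_def Q_def .
  then obtain c where "Q c" ..
  then have c: "\<forall>x\<in>verts G. c x < \<chi> G" unfolding Q_def by (rule conjunct1)
  have c2: "x = y \<or> adj (complement G) x y" if "x \<in> verts G" "y \<in> verts G" "c x = c y" for x y
    by (rule \<open>Q c\<close>[unfolded Q_def, THEN conjunct2, rule_format, OF that])
  let ?C = "\<lambda>i. {x \<in> verts G. c x = i}"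
  have C: "card (?C i) \<le> 2" for i
  proof (rule ccontr)
    assume "\<not> card (?C i) \<le> 2"
    then obtain R where R: "R \<subseteq> ?C i" "card R = 3"
      using obtain_subset_with_card_n[of 3 "?C i"] by (metis not_less_eq_eq numeral_3_eq_3 numeral_2_eq_2)
    then obtain x y z where "R = {x, y, z}" "x \<noteq> y" "y \<noteq> z" "x \<noteq> z" by (auto simp: card_3_iff)
    then have "adj (complement G) x y" "adj (complement G) y z" "adj (complement G) x z"
      using R(1) c2[of x y] c2[of y z] c2[of x z] by auto
    then show False using tri by blast
  qed
  have "card (verts G) = card (\<Union>i<\<chi> G. ?C i)"
    using c by (intro arg_cong[of _ _ card]) auto
  also have "\<dots> \<le> (\<Sum>i<\<chi> G. card (?C i))" by (rule card_UN_le) simp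
  also have "\<dots> \<le> (\<Sum>i<\<chi> G. 2)" by (rule sum_mono) (rule C)
  finally show ?thesis by simp
qed

section \<open>Executable checks of the extremal graphs, given by adjacency lists of the
  complement\<close>

definition co_graph :: "nat list list \<Rightarrow> nat graph" where
  "co_graph N = \<lparr>verts = {..<length N},
     edges = {{x, y} | x y. x < length N \<and> y < length N \<and> x \<noteq> y \<and> y \<notin> set (N ! x)}\<rparr>"

text \<open>Exclusion of P_2 + P_3 edge by edge: the vertices \<open>Q\<close> unattached to the
  edge \<open>x y\<close> must induce a graph of maximum degree at most one. This avoids running
  over all five-tuples.\<close>

definition check_graph :: "nat list list \<Rightarrow> bool" where
  "check_graph N \<longleftrightarrow> list_all (\<lambda>x. list_all (\<lambda>y. y < length N \<and> x \<noteq> y \<and> x \<in> set (N ! y) \<and>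
       list_all (\<lambda>z. z \<notin> set (N ! x)) (N ! y) \<and>
       (let Q = filter (\<lambda>q. q \<notin> set (N ! x) \<and> q \<notin> set (N ! y)) [0..<length N]
        in list_all (\<lambda>q. length (filter (\<lambda>p. p \<in> set (N ! q)) Q) \<le> 1) Q)) (N ! x)) [0..<length N]"

text \<open>Branching on the first vertex: leave it out, or take it and discard its
  neighbours.\<close>

function stability_bound :: "nat list list \<Rightarrow> nat list \<Rightarrow> nat" where
  "stability_bound N [] = 0"
| "stability_bound N (x # xs) =
     max (stability_bound N xs) (Suc (stability_bound N (filter (\<lambda>y. y \<notin> set (N ! x)) xs)))"
  by pat_completeness auto
termination
  by (relation "measure (length \<circ> snd)") (auto simp: less_Suc_eq_le)

lemma stability_bound:
  "S \<subseteq> set xs \<Longrightarrow> \<forall>x\<in>S. \<forall>y\<in>S. y \<notin> set (N ! x) \<Longrightarrow> card S \<le> stability_bound N xs"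
proof (induction N xs arbitrary: S rule: stability_bound.induct)
  case (2 N x xs)
  show ?case
  proof (cases "x \<in> S")
    case False
    then have "card S \<le> stability_bound N xs" using 2 by (intro 2(1)) auto
    then show ?thesis by simp
  next
    case True
    have fin: "finite S" using 2(3) finite_subset by blast
    have "card (S - {x}) \<le> stability_bound N (filter (\<lambda>y. y \<notin> set (N ! x)) xs)"
      using 2(3,4) True by (intro 2(2)) auto
    then show ?thesis using True fin by (simp add: card_Diff_singleton)
  qed
qed simp

lemma check_graph_D:
  assumes "check_graph N" "x < length N" "y \<in> set (N ! x)"
  shows "y < length N" "x \<noteq> y" "x \<in> set (N ! y)" "z \<in> set (N ! y) \<Longrightarrow> z \<notin> set (N ! x)"
    "\<lbrakk>p \<in> set (N ! q); r \<in> set (N ! q); p \<noteq> r; q < length N; p < length N; r < length N;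
      p \<notin> set (N ! x); q \<notin> set (N ! x); r \<notin> set (N ! x);
      p \<notin> set (N ! y); q \<notin> set (N ! y)\<rbrakk> \<Longrightarrow> r \<in> set (N ! y)"
proof -
  let ?Q = "filter (\<lambda>q. q \<notin> set (N ! x) \<and> q \<notin> set (N ! y)) [0..<length N]"
  have x: "x \<in> set [0..<length N]" using assms(2) by simp
  have *: "y < length N \<and> x \<noteq> y \<and> x \<in> set (N ! y) \<and> (\<forall>z\<in>set (N ! y). z \<notin> set (N ! x)) \<and>
    (\<forall>q\<in>set ?Q. length (filter (\<lambda>p. p \<in> set (N ! q)) ?Q) \<le> 1)"
    by (rule assms(1)[unfolded check_graph_def list_all_iff Let_def, THEN bspec, OF x, THEN bspec, OF assms(3)])
  then show "y < length N" "x \<noteq> y" "x \<in> set (N ! y)" "z \<in> set (N ! y) \<Longrightarrow> z \<notin> set (N ! x)"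
    by (elim conjE; blast)+
  assume h: "p \<in> set (N ! q)" "r \<in> set (N ! q)" "p \<noteq> r" "q < length N" "p < length N" "r < length N"
      "p \<notin> set (N ! x)" "q \<notin> set (N ! x)" "r \<notin> set (N ! x)" "p \<notin> set (N ! y)" "q \<notin> set (N ! y)"
  show "r \<in> set (N ! y)"
  proof (rule ccontr)
    assume "r \<notin> set (N ! y)"
    have "p \<in> set (filter (\<lambda>p. p \<in> set (N ! q)) ?Q)" "r \<in> set (filter (\<lambda>p. p \<in> set (N ! q)) ?Q)"
      using h \<open>r \<notin> set (N ! y)\<close> by auto
    moreover have "q \<in> set ?Q" using h by simp
    then have "length (filter (\<lambda>p. p \<in> set (N ! q)) ?Q) \<le> 1" using * by blast
    ultimately show False using h(3)
      by (cases "filter (\<lambda>p. p \<in> set (N ! q)) ?Q") (simp_all del: set_filter)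
  qed
qed

locale checked_graph =
  fixes N :: "nat list list"
  assumes check: "check_graph N"
begin

lemma verts_co [simp]: "verts (co_graph N) = {..<length N}"
  unfolding co_graph_def by simp

lemma simple_co: "simple_graph (co_graph N)"
  unfolding simple_graph_def co_graph_def by auto

lemma adj_co: "adj (complement (co_graph N)) x y \<longleftrightarrow> x < length N \<and> y \<in> set (N ! x)"
proof -
  have "adj (co_graph N) x y \<longleftrightarrow> x < length N \<and> y < length N \<and> x \<noteq> y \<and> y \<notin> set (N ! x)"
    unfolding adj_def co_graph_def using check_graph_D(3)[OF check] by (auto simp: doubleton_eq_iff)
  then show ?thesis
    unfolding adj_complement using check_graph_D(1,2)[OF check] by auto
qed

lemma p2p3_co: "p2p3_graph (verts (co_graph N)) (adj (complement (co_graph N)))"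
proof
  note D = check_graph_D[OF check]
  show "finite (verts (co_graph N))" by simp
  fix x y
  show "adj (complement (co_graph N)) x y \<Longrightarrow> x \<in> verts (co_graph N)"
    unfolding adj_co by simp
  show "adj (complement (co_graph N)) x y \<Longrightarrow> adj (complement (co_graph N)) y x"
    unfolding adj_co using D by blast
  show "adj (complement (co_graph N)) x y \<Longrightarrow> adj (complement (co_graph N)) y z \<Longrightarrow>
    \<not> adj (complement (co_graph N)) x z" for z
    unfolding adj_co using D by blast
  fix a b p q r
  assume "adj (complement (co_graph N)) a b" "adj (complement (co_graph N)) p q"
    "adj (complement (co_graph N)) q r" "p \<noteq> r"
  then have h: "a < length N" "b \<in> set (N ! a)" "p < length N" "q \<in> set (N ! p)"
    "q < length N" "r \<in> set (N ! q)" "p \<noteq> r" "b < length N" "p \<in> set (N ! q)" "r < length N"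
    unfolding adj_co using D by blast+
  show "adj (complement (co_graph N)) a p \<or> adj (complement (co_graph N)) a q \<or>
    adj (complement (co_graph N)) a r \<or> adj (complement (co_graph N)) b p \<or>
    adj (complement (co_graph N)) b q \<or> adj (complement (co_graph N)) b r"
    unfolding adj_co using D(5)[OF h(1,2,9,6,7,5,3,10)] h by blast
qed

lemma clique_number_co: "\<omega> (co_graph N) \<le> stability_bound N [0..<length N]"
proof (rule clique_number_le[OF simple_co], unfold stability_le_def, intro allI impI)
  fix S assume S: "S \<subseteq> verts (co_graph N)" "stable (adj (complement (co_graph N))) S"
  show "card S \<le> stability_bound N [0..<length N]"
    by (rule stability_bound) (use S in \<open>auto simp: stable_def adj_co\<close>)
qed

lemma chromatic_number_co: "length N \<le> 2 * \<chi> (co_graph N)"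
  using triangle_free_chromatic_number_ge[OF simple_co p2p3_co] by simp

text \<open>Every vertex lies within distance two of the cycle, so the complement is connected and
  serves as H itself.\<close>

lemma admissible_co:
  assumes C5: "induced_5_cycle (complement (co_graph N)) v"
    and reach: "\<And>x. x < length N \<Longrightarrow> \<exists>i. x = v i \<or> v i \<in> set (N ! x) \<or> (\<exists>y\<in>set (N ! x). v i \<in> set (N ! y))"
  shows "admissible (co_graph N) (complement (co_graph N)) v"
proof -
  let ?G = "co_graph N" and ?\<Gamma> = "complement (co_graph N)"
  let ?E = "adj ?\<Gamma>"
  have inj: "inj v" and sub: "range v \<subseteq> verts ?G" and cyc: "\<And>i j. ?E (v i) (v j) \<longleftrightarrow> j = i + 1 \<or> i = j + 1"
    using C5 unfolding induced_5_cycle_def by auto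
  interpret p2p3_graph "verts ?G" ?E by (rule p2p3_co)
  have step: "?E\<^sup>*\<^sup>* (v 0) y" if "?E\<^sup>*\<^sup>* (v 0) x" "?E y x" for x y
    using that adj_sym by (meson rtranclp.rtrancl_into_rtrancl)
  have cycle_reach: "?E\<^sup>*\<^sup>* (v 0) (v i)" for i
  proof -
    have 0: "?E\<^sup>*\<^sup>* (v 0) (v 0)" by simp
    have 1: "?E\<^sup>*\<^sup>* (v 0) (v 1)" by (rule step[OF 0]) (simp add: cyc)
    have 2: "?E\<^sup>*\<^sup>* (v 0) (v 2)" by (rule step[OF 1]) (simp add: cyc)
    have 3: "?E\<^sup>*\<^sup>* (v 0) (v 3)" by (rule step[OF 2]) (simp add: cyc)
    have 4: "?E\<^sup>*\<^sup>* (v 0) (v 4)" by (rule step[OF 3]) (simp add: cyc)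
    show ?thesis using cases_5[of i] 0 1 2 3 4 by auto
  qed
  have "?E\<^sup>*\<^sup>* (v 0) x \<longleftrightarrow> x \<in> verts ?G" for x
  proof
    show "?E\<^sup>*\<^sup>* (v 0) x \<Longrightarrow> x \<in> verts ?G"
      by (induction rule: rtranclp_induct) (use sub in \<open>auto simp: adj_complement\<close>)
    assume "x \<in> verts ?G"
    then have x: "x < length N" by simp
    then obtain i where "x = v i \<or> ?E x (v i) \<or> (\<exists>y. ?E x y \<and> ?E y (v i))"
      using reach[OF x] check_graph_D(1)[OF check x] unfolding adj_co by blast
    then show "?E\<^sup>*\<^sup>* (v 0) x" using cycle_reach[of i] step by blast
  qed
  then have all: "{y. ?E\<^sup>*\<^sup>* (v 0) y} = verts ?\<Gamma>" by auto
  have "induced ?\<Gamma> (verts ?\<Gamma>) = ?\<Gamma>"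
    unfolding induced_def by (auto simp: complement_def)
  then have comp: "is_component ?\<Gamma> ?\<Gamma>"
    unfolding is_component_def using all sub by (intro bexI[of _ "v 0"]) auto
  have "simple_graph ?\<Gamma>" unfolding simple_graph_def complement_def by auto
  then have H: "\<not> perfect ?\<Gamma>" by (rule imperfect_of_C5[OF _ inj]) (use sub cyc in auto)
  have "\<not> perfect ?G"
  \<comment> \<open>The 5-cycle is self-complementary: doubling the indices turns the cycle of the
    complement into an induced 5-cycle of the graph.\<close>
  proof (rule imperfect_of_C5[OF simple_co, of "\<lambda>i. v (2 * i)"])
    have two: "2 * i = 2 * j \<longleftrightarrow> i = j" for i j :: 5 using cases_5[of i] cases_5[of j] by auto
    show "inj (\<lambda>i. v (2 * i))" by (rule injI) (simp only: inj_eq[OF inj] two)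
    show "range (\<lambda>i. v (2 * i)) \<subseteq> verts ?G" using sub by auto
    show "adj ?G (v (2 * i)) (v (2 * j)) \<longleftrightarrow> j = i + 1 \<or> i = j + 1" for i j
    proof -
      have "adj ?G (v (2 * i)) (v (2 * j)) \<longleftrightarrow> i \<noteq> j \<and> \<not> ?E (v (2 * i)) (v (2 * j))"
        using subsetD[OF sub] simple_graph_irrefl[OF simple_co]
        unfolding adj_complement inj_eq[OF inj] two by auto
      also have "\<dots> \<longleftrightarrow> j = i + 1 \<or> i = j + 1"
        unfolding cyc using cases_5[of i] cases_5[of j] by (elim disjE) simp_all
      finally show ?thesis .
    qed
  qed
  then show ?thesis
    unfolding admissible_def
    using simple_co free_iff_p2p3_graph[OF simple_co] p2p3_co comp H C5 by blast
qed

end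

definition first_five :: "5 \<Rightarrow> nat" where
  "first_five i = (if i = 0 then 0 else if i = 1 then 1 else if i = 2 then 2 else if i = 3 then 3 else 4)"

lemma first_five [simp]:
  "first_five 0 = 0" "first_five 1 = 1" "first_five 2 = 2" "first_five 3 = 3" "first_five 4 = 4"
  unfolding first_five_def by simp_all

lemma inj_first_five: "inj first_five"
proof (rule injI)
  show "i = j" if "first_five i = first_five j" for i j
    using that cases_5[of i] cases_5[of j] by (elim disjE) simp_all
qed

text \<open>The 5-cycle is 0, ..., 4; then \<open>B 0 = {5, 6}\<close>, \<open>B 1 = {7, 8}\<close>, and \<open>S\<^sub>2 = {9, 10}\<close> has one vertex
  for each of the two nonadjacent pairs between \<open>B 0\<close> and \<open>B 1\<close>.\<close>

definition graph_B1 :: "nat list list" where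
  "graph_B1 =
   [[1, 4, 7, 8], [0, 2, 5, 6], [1, 3, 7, 8], [2, 4], [0, 3, 5, 6], [1, 4, 8, 9], [1, 4, 7, 10],
    [0, 2, 6, 9], [0, 2, 5, 10], [5, 7], [6, 8]]"

lemma length_graph_B1 [simp]: "length graph_B1 = 11"
  unfolding graph_B1_def by simp

lemma nth_graph_B1:
  "graph_B1 ! 0 = [1, 4, 7, 8]"
  "graph_B1 ! Suc 0 = [0, 2, 5, 6]"
  "graph_B1 ! 2 = [1, 3, 7, 8]"
  "graph_B1 ! 3 = [2, 4]"
  "graph_B1 ! 4 = [0, 3, 5, 6]"
  "graph_B1 ! 5 = [1, 4, 8, 9]"
  "graph_B1 ! 6 = [1, 4, 7, 10]"
  "graph_B1 ! 7 = [0, 2, 6, 9]"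
  "graph_B1 ! 8 = [0, 2, 5, 10]"
  "graph_B1 ! 9 = [5, 7]"
  "graph_B1 ! 10 = [6, 8]"
  unfolding graph_B1_def by simp_all

lemma check_graph_B1: "check_graph graph_B1"
  by code_simp

lemma stability_bound_graph_B1: "stability_bound graph_B1 [0..<11] = 4"
  by code_simp

interpretation graph_B1: checked_graph graph_B1
  by unfold_locales (rule check_graph_B1)

lemma less_graph_B1: "x < 11 \<Longrightarrow> x = 0 \<or> x = 1 \<or> x = 2 \<or> x = 3 \<or> x = 4 \<or> x = 5 \<or> x = 6 \<or> x = 7 \<or> x = 8 \<or> x = 9 \<or> x = 10" for x :: nat
  by presburger

lemma admissible_graph_B1: "admissible (co_graph graph_B1) (complement (co_graph graph_B1)) first_five"
proof (rule graph_B1.admissible_co)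
  show "induced_5_cycle (complement (co_graph graph_B1)) first_five"
    unfolding induced_5_cycle_def
  proof (intro conjI allI inj_first_five)
    show "range first_five \<subseteq> verts (complement (co_graph graph_B1))"
      by (auto simp: first_five_def)
    show "adj (complement (co_graph graph_B1)) (first_five i) (first_five j) \<longleftrightarrow> j = i + 1 \<or> i = j + 1" for i j
      unfolding graph_B1.adj_co using cases_5[of i] cases_5[of j]
      by (elim disjE) (simp_all add: nth_graph_B1)
  qed
  show "\<exists>i. x = first_five i \<or> first_five i \<in> set (graph_B1 ! x) \<or>
      (\<exists>y\<in>set (graph_B1 ! x). first_five i \<in> set (graph_B1 ! y))" if "x < length graph_B1" for x
  proof -
    have "x < 11" using that by simp
    from less_graph_B1[OF this] show ?thesis
      unfolding ex_5 by (elim disjE) (simp_all add: nth_graph_B1)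
  qed
qed

text \<open>The 5-cycle with every vertex doubled: \<open>5 + i\<close> is the twin of
  \<open>i\<close> and the only element of \<open>B i\<close>.\<close>

definition graph_B2 :: "nat list list" where
  "graph_B2 =
   [[1, 4, 6, 9], [0, 2, 5, 7], [1, 3, 6, 8], [2, 4, 7, 9], [0, 3, 5, 8],
    [1, 4, 6, 9], [0, 2, 5, 7], [1, 3, 6, 8], [2, 4, 7, 9], [0, 3, 5, 8]]"

lemma length_graph_B2 [simp]: "length graph_B2 = 10"
  unfolding graph_B2_def by simp

lemma nth_graph_B2:
  "graph_B2 ! 0 = [1, 4, 6, 9]"
  "graph_B2 ! Suc 0 = [0, 2, 5, 7]"
  "graph_B2 ! 2 = [1, 3, 6, 8]"
  "graph_B2 ! 3 = [2, 4, 7, 9]"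
  "graph_B2 ! 4 = [0, 3, 5, 8]"
  "graph_B2 ! 5 = [1, 4, 6, 9]"
  "graph_B2 ! 6 = [0, 2, 5, 7]"
  "graph_B2 ! 7 = [1, 3, 6, 8]"
  "graph_B2 ! 8 = [2, 4, 7, 9]"
  "graph_B2 ! 9 = [0, 3, 5, 8]"
  unfolding graph_B2_def by simp_all

lemma check_graph_B2: "check_graph graph_B2"
  by code_simp

lemma stability_bound_graph_B2: "stability_bound graph_B2 [0..<10] = 4"
  by code_simp

interpretation graph_B2: checked_graph graph_B2
  by unfold_locales (rule check_graph_B2)

lemma less_graph_B2: "x < 10 \<Longrightarrow> x = 0 \<or> x = 1 \<or> x = 2 \<or> x = 3 \<or> x = 4 \<or> x = 5 \<or> x = 6 \<or> x = 7 \<or> x = 8 \<or> x = 9" for x :: nat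
  by presburger

lemma admissible_graph_B2: "admissible (co_graph graph_B2) (complement (co_graph graph_B2)) first_five"
proof (rule graph_B2.admissible_co)
  show "induced_5_cycle (complement (co_graph graph_B2)) first_five"
    unfolding induced_5_cycle_def
  proof (intro conjI allI inj_first_five)
    show "range first_five \<subseteq> verts (complement (co_graph graph_B2))"
      by (auto simp: first_five_def)
    show "adj (complement (co_graph graph_B2)) (first_five i) (first_five j) \<longleftrightarrow> j = i + 1 \<or> i = j + 1" for i j
      unfolding graph_B2.adj_co using cases_5[of i] cases_5[of j]
      by (elim disjE) (simp_all add: nth_graph_B2)
  qed
  show "\<exists>i. x = first_five i \<or> first_five i \<in> set (graph_B2 ! x) \<or>
      (\<exists>y\<in>set (graph_B2 ! x). first_five i \<in> set (graph_B2 ! y))" if "x < length graph_B2" for x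
  proof -
    have "x < 10" using that by simp
    from less_graph_B2[OF this] show ?thesis
      unfolding ex_5 by (elim disjE) (simp_all add: nth_graph_B2)
  qed
qed

text \<open>The Clebsch graph: the 5-cycle is 0, ..., 4, followed by the one-element sets \<open>A i = {5 + i}\<close>,
  \<open>B i = {10 + i}\<close> and \<open>S\<^sub>2 = {15}\<close>.\<close>

definition graph_other :: "nat list list" where
  "graph_other =
   [[1, 4, 5, 11, 14], [0, 2, 6, 10, 12], [1, 3, 7, 11, 13], [2, 4, 8, 12, 14], [0, 3, 9, 10, 13],
    [0, 7, 8, 12, 13], [1, 8, 9, 13, 14], [2, 5, 9, 10, 14], [3, 5, 6, 10, 11], [4, 6, 7, 11, 12],
    [1, 4, 7, 8, 15], [0, 2, 8, 9, 15], [1, 3, 5, 9, 15], [2, 4, 5, 6, 15], [0, 3, 6, 7, 15], [10, 11, 12, 13, 14]]"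

lemma length_graph_other [simp]: "length graph_other = 16"
  unfolding graph_other_def by simp

lemma nth_graph_other:
  "graph_other ! 0 = [1, 4, 5, 11, 14]"
  "graph_other ! Suc 0 = [0, 2, 6, 10, 12]"
  "graph_other ! 2 = [1, 3, 7, 11, 13]"
  "graph_other ! 3 = [2, 4, 8, 12, 14]"
  "graph_other ! 4 = [0, 3, 9, 10, 13]"
  "graph_other ! 5 = [0, 7, 8, 12, 13]"
  "graph_other ! 6 = [1, 8, 9, 13, 14]"
  "graph_other ! 7 = [2, 5, 9, 10, 14]"
  "graph_other ! 8 = [3, 5, 6, 10, 11]"
  "graph_other ! 9 = [4, 6, 7, 11, 12]"
  "graph_other ! 10 = [1, 4, 7, 8, 15]"
  "graph_other ! 11 = [0, 2, 8, 9, 15]"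
  "graph_other ! 12 = [1, 3, 5, 9, 15]"
  "graph_other ! 13 = [2, 4, 5, 6, 15]"
  "graph_other ! 14 = [0, 3, 6, 7, 15]"
  "graph_other ! 15 = [10, 11, 12, 13, 14]"
  unfolding graph_other_def by simp_all

lemma check_graph_other: "check_graph graph_other"
  by code_simp

lemma stability_bound_graph_other: "stability_bound graph_other [0..<16] = 5"
  by code_simp

interpretation graph_other: checked_graph graph_other
  by unfold_locales (rule check_graph_other)

lemma less_graph_other: "x < 16 \<Longrightarrow> x = 0 \<or> x = 1 \<or> x = 2 \<or> x = 3 \<or> x = 4 \<or> x = 5 \<or> x = 6 \<or> x = 7 \<or> x = 8 \<or> x = 9 \<or> x = 10 \<or> x = 11 \<or> x = 12 \<or> x = 13 \<or> x = 14 \<or> x = 15" for x :: nat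
  by presburger

lemma admissible_graph_other: "admissible (co_graph graph_other) (complement (co_graph graph_other)) first_five"
proof (rule graph_other.admissible_co)
  show "induced_5_cycle (complement (co_graph graph_other)) first_five"
    unfolding induced_5_cycle_def
  proof (intro conjI allI inj_first_five)
    show "range first_five \<subseteq> verts (complement (co_graph graph_other))"
      by (auto simp: first_five_def)
    show "adj (complement (co_graph graph_other)) (first_five i) (first_five j) \<longleftrightarrow> j = i + 1 \<or> i = j + 1" for i j
      unfolding graph_other.adj_co using cases_5[of i] cases_5[of j]
      by (elim disjE) (simp_all add: nth_graph_other)
  qed
  show "\<exists>i. x = first_five i \<or> first_five i \<in> set (graph_other ! x) \<or>
      (\<exists>y\<in>set (graph_other ! x). first_five i \<in> set (graph_other ! y))" if "x < length graph_other" for x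
  proof -
    have "x < 16" using that by simp
    from less_graph_other[OF this] show ?thesis
      unfolding ex_5 by (elim disjE) (simp_all add: nth_graph_other)
  qed
qed

section \<open>Classes and exact values of the three examples\<close>

lemma class_B1_graph_B1: "class_B1 (complement (co_graph graph_B1)) first_five"
proof -
  interpret component_graph "verts (co_graph graph_B1)" "adj (complement (co_graph graph_B1))" first_five
    "complement (co_graph graph_B1)"
    using admissible_graph_B1 by (rule admissible_component_graph)
  note E = graph_B1.adj_co nth_graph_B1
  have V: "x = 0 \<or> x = 1 \<or> x = 2 \<or> x = 3 \<or> x = 4 \<or> x = 5 \<or> x = 6 \<or> x = 7 \<or> x = 8 \<or> x = 9 \<or> x = 10"
    if "x \<in> B i" for x i
    using less_graph_B1[of x] sub_V(4)[of i] that by auto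
  have B0: "x = 5 \<or> x = 6" if "x \<in> B 0" for x
    using V[OF that] that unfolding B_def P_def all_5 by (elim disjE) (simp_all add: E)
  have B1: "x = 7 \<or> x = 8" if "x \<in> B 1" for x
    using V[OF that] that unfolding B_def P_def all_5 by (elim disjE) (simp_all add: E)
  have "False" if "x \<in> B 2" for x
    using V[OF that] that unfolding B_def P_def all_5 by (elim disjE) (simp_all add: E)
  moreover have "False" if "x \<in> B 3" for x
    using V[OF that] that unfolding B_def P_def all_5 by (elim disjE) (simp_all add: E)
  moreover have "False" if "x \<in> B 4" for x
    using V[OF that] that unfolding B_def P_def all_5 by (elim disjE) (simp_all add: E)
  ultimately have B: "B 2 = {}" "B 3 = {}" "B 4 = {}" by blast+
  have m: "5 \<in> B 0" "6 \<in> B 0" "7 \<in> B 1" "8 \<in> B 1"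
    unfolding B_def P_def all_5 by (simp_all add: E)
  have Z: "9 \<in> Z" "10 \<in> Z" unfolding Z_def all_5 by (simp_all add: E)
  have e: "adj (complement (co_graph graph_B1)) 5 8" "adj (complement (co_graph graph_B1)) 5 9"
    "adj (complement (co_graph graph_B1)) 6 10" "adj (complement (co_graph graph_B1)) 7 9"
    "adj (complement (co_graph graph_B1)) 8 10" "adj (complement (co_graph graph_B1)) 9 5"
    "adj (complement (co_graph graph_B1)) 9 7"
    by (simp_all add: E)
  have U: "U 0 = {}" "U 1 = {}"
    using B0 B1 e Z unfolding U_def by blast+
  have "9 \<in> T 0" unfolding T_def using Z(1) e(6,7) m by auto
  then have "card (T 0) > 0" using fin_UT(2)[of 0] card_gt_0_iff by blast
  then have "balanced 0" unfolding balanced_def using U by simp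
  moreover have "\<forall>j. B j \<noteq> {} \<longleftrightarrow> j = 0 \<or> j = 0 + 1"
    unfolding all_5 using m B by auto
  moreover have "\<exists>x\<in>B 0. \<exists>y\<in>B (0 + 1). adj (complement (co_graph graph_B1)) x y"
    using m(1,4) e(1) by auto
  ultimately have type1 unfolding type1_def by blast
  then show ?thesis using class_B1_iff by blast
qed

lemma class_B2_graph_B2: "class_B2 (complement (co_graph graph_B2)) first_five"
proof -
  interpret component_graph "verts (co_graph graph_B2)" "adj (complement (co_graph graph_B2))" first_five
    "complement (co_graph graph_B2)"
    using admissible_graph_B2 by (rule admissible_component_graph)
  note E = graph_B2.adj_co nth_graph_B2
  note V = less_graph_B2
  have lt: "x \<in> Z \<Longrightarrow> x < 10" "x \<in> A i \<Longrightarrow> x < 10" for x i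
    using sub_V(2)[of i] sub_V(3) by auto
  have "False" if "x \<in> Z" for x
    using V[OF lt(1)[OF that]] that unfolding Z_def all_5 by (elim disjE) (simp_all add: E)
  moreover have "False" if "x \<in> A j" for x j
    using V[OF lt(2)[OF that]] A_v[OF that, of 0] A_v[OF that, of 1] A_v[OF that, of 2]
      A_v[OF that, of 3] A_v[OF that, of 4]
    by (elim disjE) (simp_all add: E)
  then have "\<forall>j. A j = {}" by blast
  moreover have m: "5 \<in> B 0" "6 \<in> B 1" "7 \<in> B 2" "8 \<in> B 3" "9 \<in> B 4"
    unfolding B_def P_def all_5 by (simp_all add: E)
  have e: "adj (complement (co_graph graph_B2)) 5 6" "adj (complement (co_graph graph_B2)) 6 7"
    "adj (complement (co_graph graph_B2)) 7 8" "adj (complement (co_graph graph_B2)) 8 9"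
    "adj (complement (co_graph graph_B2)) 9 5"
    by (simp_all add: E)
  have s: "(0 :: 5) + 1 = 1" "(1 :: 5) + 1 = 2" "(2 :: 5) + 1 = 3" "(3 :: 5) + 1 = 4" "(4 :: 5) + 1 = 0"
    by simp_all
  have "\<forall>j. \<exists>x\<in>B j. \<exists>y\<in>B (j + 1). adj (complement (co_graph graph_B2)) x y"
    unfolding all_5 s using m e by blast
  ultimately have type2 unfolding type2_def by blast
  then show ?thesis using class_B2_iff by blast
qed

lemma no_class_graph_other:
  "\<not> class_B1 (complement (co_graph graph_other)) first_five"
  "\<not> class_B2 (complement (co_graph graph_other)) first_five"
proof -
  interpret component_graph "verts (co_graph graph_other)" "adj (complement (co_graph graph_other))" first_five
    "complement (co_graph graph_other)"
    using admissible_graph_other by (rule admissible_component_graph)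
  note E = graph_other.adj_co nth_graph_other
  have "10 \<in> B 0" "11 \<in> B 1" "12 \<in> B 2" "13 \<in> B 3" "14 \<in> B 4"
    unfolding B_def P_def all_5 by (simp_all add: E)
  then have ne: "B 0 \<noteq> {}" "B 1 \<noteq> {}" "B 2 \<noteq> {}" "B 3 \<noteq> {}" "B 4 \<noteq> {}" by blast+
  have "\<not> (\<forall>j. B j \<noteq> {} \<longleftrightarrow> j = i \<or> j = i + 1)" for i
    unfolding all_5 using ne cases_5[of i] by (elim disjE) simp_all
  then have "\<not> type1" unfolding type1_def by blast
  then show "\<not> class_B1 (complement (co_graph graph_other)) first_five" using class_B1_iff by blast
  have "15 \<in> Z" unfolding Z_def all_5 by (simp_all add: E)
  moreover have "adj (complement (co_graph graph_other)) 15 10" by (simp add: E)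
  ultimately have "\<not> type2" unfolding type2_def by blast
  then show "\<not> class_B2 (complement (co_graph graph_other)) first_five" using class_B2_iff by blast
qed

text \<open>The value is squeezed: 11 vertices in classes of size at most two give 6 as a lower
  bound, and clique number at most 4 gives 6 as an upper bound. The other two examples pinch at 5
  (10 vertices, clique number 4) and at 8 (16 vertices, clique number 5).\<close>

lemma tight_B1: "real (\<chi> (co_graph graph_B1)) = 2 * real (\<omega> (co_graph graph_B1)) - 2"
proof -
  have "\<chi> (co_graph graph_B1) \<ge> 6" using graph_B1.chromatic_number_co by simp
  moreover have "\<omega> (co_graph graph_B1) \<le> 4"
    using graph_B1.clique_number_co by (simp add: stability_bound_graph_B1)
  ultimately show ?thesis
    using upper_bounds(1)[OF admissible_graph_B1 class_B1_graph_B1]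
    by linarith
qed

lemma tight_B2: "real (\<chi> (co_graph graph_B2)) = 3 * real (\<omega> (co_graph graph_B2)) / 2 - 1"
proof -
  have "\<chi> (co_graph graph_B2) \<ge> 5" using graph_B2.chromatic_number_co by simp
  moreover have "\<omega> (co_graph graph_B2) \<le> 4"
    using graph_B2.clique_number_co by (simp add: stability_bound_graph_B2)
  ultimately show ?thesis
    using upper_bounds(2)[OF admissible_graph_B2 class_B2_graph_B2]
    by linarith
qed

lemma tight_other: "real (\<chi> (co_graph graph_other)) = real (\<omega> (co_graph graph_other)) + 3"
proof -
  have "\<chi> (co_graph graph_other) \<ge> 8" using graph_other.chromatic_number_co by simp
  moreover have "\<omega> (co_graph graph_other) \<le> 5"
    using graph_other.clique_number_co by (simp add: stability_bound_graph_other)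
  ultimately show ?thesis
    using upper_bounds(3)[OF admissible_graph_other no_class_graph_other]
    by linarith
qed

theorem theorem1p11:
  shows
    "(\<forall>G :: 'a graph. simple_graph G \<and> free_of {three_K1, paraglider} G \<longrightarrow>
        real (\<chi> G) \<le> max (real (\<omega> G) + 3) (2 * real (\<omega> G) - 2)) \<and>
     (\<forall>(G :: 'a graph) H v. admissible G H v \<longrightarrow>
        (class_B1 H v \<longrightarrow> real (\<chi> G) \<le> 2 * real (\<omega> G) - 2) \<and>
        (class_B2 H v \<longrightarrow> real (\<chi> G) \<le> 3 * real (\<omega> G) / 2 - 1) \<and>
        (\<not> class_B1 H v \<and> \<not> class_B2 H v \<longrightarrow> real (\<chi> G) \<le> real (\<omega> G) + 3)) \<and>
     (\<exists>(G :: nat graph) H v. admissible G H v \<and> class_B1 H v \<and>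
        real (\<chi> G) = 2 * real (\<omega> G) - 2) \<and>
     (\<exists>(G :: nat graph) H v. admissible G H v \<and> class_B2 H v \<and>
        real (\<chi> G) = 3 * real (\<omega> G) / 2 - 1) \<and>
     (\<exists>(G :: nat graph) H v. admissible G H v \<and> \<not> class_B1 H v \<and> \<not> class_B2 H v \<and>
        real (\<chi> G) = real (\<omega> G) + 3)"
  using general_bound upper_bounds admissible_graph_B1 class_B1_graph_B1 tight_B1
    admissible_graph_B2 class_B2_graph_B2 tight_B2 admissible_graph_other no_class_graph_other tight_other
  by (intro conjI) blast+

end
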